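(* Let $1\le p<q<\infty$, $0<\theta_2<\infty$ and $\omega\in A^{\rho,\theta_2}_{p,q}(\mathbb R^d)$. Let $0<\beta<1$ and let $N_0$ be the constant fixed in the context. Then the following statements are true. (1) Let $0<\theta_1<\infty$. There is a constant $C>0$, independent of $f$ and $\mathcal B$, such that for every $f\in \mathrm{Lip}_\beta^{\rho,\theta_1}(\mathbb R^d)$ and every ball $\mathcal B=B(x_0,r)\subset\mathbb R^d$, $$\frac{1}{|\mathcal B|^{\beta/d}}\bigg(\frac{1}{\omega^q(\mathcal B)}\int_{\mathcal B}|f(x)-f_{\mathcal B}|^q\,\omega(x)^q\,dx\bigg)^{1/q}\le C\bigg(1+\frac{r}{\rho(x_0)}\bigg)^{(N_0+1)\theta_1}\|f\|_{\mathrm{Lip}_\beta^{\rho,\theta_1}}.$$ (2) Conversely, let $f\in L^1_{\mathrm{loc}}(\mathbb R^d)$ be real-valued. If there exist a constant $C>0$ and some $\theta_1>0$ such that for every ball $\mathcal B=B(x_0,r)\subset\mathbb R^d$, $$\frac{1}{|\mathcal B|^{\beta/d}}\bigg(\frac{1}{\omega^q(\mathcal B)}\int_{\mathcal B}|f(x)-f_{\mathcal B}|^q\,\omega(x)^q\,dx\bigg)^{1/q}\le C\bigg(1+\frac{r}{\rho(x_0)}\bigg)^{\theta_1-\theta_2},$$ then $f\in \mathrm{Lip}_\beta^{\rho,\theta_1}(\mathbb R^d)$ and $$\|f\|_{\mathrm{Lip}_\beta^{\rho,\theta_1}}\le C'\,[\omega]_{A^{\rho,\theta_2}_{p,q}},$$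 where $C'>0$ depends only on $C,d,p,q,\beta,\theta_1,\theta_2$.
   Context: Setting: $d\ge 3$, and $V:\mathbb R^d\to[0,\infty)$ is locally integrable, not identically zero, and belongs to the reverse Hölder class $RH_s(\mathbb R^d)$ for some $s\ge d/2$, i.e. there is a constant $C>0$ with $\big(\frac1{|B|}\int_B V^s\big)^{1/s}\le C\,\frac1{|B|}\int_B V$ for every ball $B$ (usual modification if $s=\infty$). $B(x,r)$ is the open ball with center $x$ and radius $r$. The critical radius function is $$\rho(x):=\sup\Big\{r>0:\ \frac{1}{r^{d-2}}\int_{B(x,r)}V(y)\,dy\le 1\Big\},\qquad x\in\mathbb R^d,$$ which satisfies $0<\rho(x)<\infty$. Constant $N_0$: it is known (Shen) that there are constants $C_0\ge1$, $N_0>0$ such that for all $x,y\in\mathbb R^d$ $$\frac1{C_0}\Big(1+\frac{|x-y|}{\rho(x)}\Big)^{-N_0}\le\frac{\rho(y)}{\rho(x)}\le C_0\Big(1+\frac{|x-y|}{\rho(x)}\Big)^{\frac{N_0}{N_0+1}};$$ such constants are fixed. Weights: a weight is a nonnegative locally integrable function $\omega$ on $\mathbb R^d$, not a.e. zero; $\omega^q(E):=\int_E\omega(x)^q\,dx$. Let $p'$ denote the conjugate exponent, $1/p+1/p'=1$. For $0<\theta<\infty$ and $1<p,q<\infty$, $\omega\in A_{p,q}^{\rho,\theta}(\mathbb R^d)$ means $[\omega]_{A_{p,q}^{\rho,\theta}}<\infty$, where $$[\omega]_{A^{\rho,\theta}_{p,q}}:=\sup_{B=B(x_0,r)}\Big(1+\frac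 r{\rho(x_0)}\Big)^{-\theta}\Big(\frac1{|B|}\int_B\omega^q\Big)^{1/q}\Big(\frac1{|B|}\int_B\omega^{-p'}\Big)^{1/p'},$$ and, for $1<q<\infty$, $\omega\in A_{1,q}^{\rho,\theta}(\mathbb R^d)$ means $[\omega]_{A_{1,q}^{\rho,\theta}}:=\sup_{B=B(x_0,r)}\big(1+\frac r{\rho(x_0)}\big)^{-\theta}\big(\frac1{|B|}\int_B\omega^q\big)^{1/q}\big(\operatorname{ess\,inf}_{B}\omega\big)^{-1}<\infty$. Lipschitz spaces: $f_B:=\frac1{|B|}\int_B f$. For $0<\theta<\infty$ and $0<\beta<1$, $\mathrm{Lip}_\beta^{\rho,\theta}(\mathbb R^d)$ is the set of real-valued $f\in L^1_{\mathrm{loc}}(\mathbb R^d)$ with $$\|f\|_{\mathrm{Lip}_\beta^{\rho,\theta}}:=\sup_{B=B(x_0,r)}\Big(1+\frac r{\rho(x_0)}\Big)^{-\theta}\frac1{|B|^{1+\beta/d}}\int_B|f(x)-f_B|\,dx<\infty,$$ the supremum being over all balls $B(x_0,r)$, $x_0\in\mathbb R^d$, $r>0$. Elements of $\mathrm{Lip}_\beta^{\rho,\theta}$ are identified with their continuous representatives. *)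

theory Defs
  imports "HOL-Probability.Essential_Supremum"
begin

definition locally_integrable :: "(real ^ 'n \<Rightarrow> real) \<Rightarrow> bool" where
  "locally_integrable f \<longleftrightarrow> (\<forall>K. compact K \<longrightarrow> f absolutely_integrable_on K)"

definition avg :: "(real ^ 'n) set \<Rightarrow> (real ^ 'n \<Rightarrow> real) \<Rightarrow> real" where
  "avg B f = (LINT x:B|lebesgue. f x) / measure lebesgue B"

text \<open>Integrals of nonnegative functions that need not be finite a priori are taken in
  \<^typ>\<open>ennreal\<close>, so that a divergent integral is infinite rather than \<open>0\<close>.\<close>

definition nn_avg :: "(real ^ 'n) set \<Rightarrow> (real ^ 'n \<Rightarrow> ennreal) \<Rightarrow> ennreal" where
  "nn_avg B g = (\<integral>\<^sup>+x\<in>B. g x \<partial>lebesgue) / emeasure lebesgue B"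

text \<open>Real powers on \<^typ>\<open>ennreal\<close>; only meaningful for (and only applied to) exponents \<open>a > 0\<close>.\<close>

definition ennreal_rpow :: "ennreal \<Rightarrow> real \<Rightarrow> ennreal" where
  "ennreal_rpow x a = (if x = \<infinity> then \<infinity> else ennreal (enn2real x powr a))"

definition ess_inf_on :: "(real ^ 'n) set \<Rightarrow> (real ^ 'n \<Rightarrow> real) \<Rightarrow> ennreal" where
  "ess_inf_on B f = Sup {c. AE x in lebesgue. x \<in> B \<longrightarrow> c \<le> ennreal (f x)}"

definition reverse_hoelder :: "ennreal \<Rightarrow> (real ^ 'n \<Rightarrow> real) \<Rightarrow> bool" where
  "reverse_hoelder s V \<longleftrightarrow> (\<exists>C>0. \<forall>x r. 0 < r \<longrightarrow>
     (if s = \<infinity> then esssup (lebesgue_on (ball x r)) (\<lambda>y. ennreal (V y))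
      else ennreal_rpow (nn_avg (ball x r) (\<lambda>y. ennreal (V y powr enn2real s))) (1 / enn2real s))
     \<le> ennreal C * nn_avg (ball x r) (\<lambda>y. ennreal (V y)))"

text \<open>Functions are elements of \<open>L\<^sup>1\<close>-type spaces, so ``not identically zero'' means not zero
  almost everywhere.\<close>

definition schrodinger_potential :: "(real ^ 'n \<Rightarrow> real) \<Rightarrow> bool" where
  "schrodinger_potential V \<longleftrightarrow>
     (\<forall>x. 0 \<le> V x) \<and> locally_integrable V \<and> \<not> (AE x in lebesgue. V x = 0) \<and>
     (\<exists>s \<ge> ennreal (real CARD('n) / 2). reverse_hoelder s V)"

text \<open>The supremum is taken in the extended half-line; for the potentials above it is positive and
  finite, so the conversion to \<^typ>\<open>real\<close> loses nothing.\<close>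

definition critical_radius :: "(real ^ 'n \<Rightarrow> real) \<Rightarrow> real ^ 'n \<Rightarrow> real" where
  "critical_radius V x = enn2real (Sup {ennreal r |r. 0 < r \<and>
     1 / r ^ (CARD('n) - 2) * (LINT y:ball x r|lebesgue. V y) \<le> 1})"

text \<open>Shen's comparison of the values of the critical radius function at two points.\<close>

definition shen_constants :: "(real ^ 'n \<Rightarrow> real) \<Rightarrow> real \<Rightarrow> real \<Rightarrow> bool" where
  "shen_constants \<rho> C\<^sub>0 N\<^sub>0 \<longleftrightarrow> 1 \<le> C\<^sub>0 \<and> 0 < N\<^sub>0 \<and>
     (\<forall>x y. 1 / C\<^sub>0 * (1 + dist x y / \<rho> x) powr (- N\<^sub>0) \<le> \<rho> y / \<rho> x \<and>
            \<rho> y / \<rho> x \<le> C\<^sub>0 * (1 + dist x y / \<rho> x) powr (N\<^sub>0 / (N\<^sub>0 + 1)))"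

definition weight :: "(real ^ 'n \<Rightarrow> real) \<Rightarrow> bool" where
  "weight \<omega> \<longleftrightarrow> (\<forall>x. 0 \<le> \<omega> x) \<and> locally_integrable \<omega> \<and> \<not> (AE x in lebesgue. \<omega> x = 0)"

definition weight_measure :: "(real ^ 'n \<Rightarrow> real) \<Rightarrow> real \<Rightarrow> (real ^ 'n) set \<Rightarrow> ennreal" where
  "weight_measure \<omega> q E = (\<integral>\<^sup>+x\<in>E. ennreal (\<omega> x powr q) \<partial>lebesgue)"

text \<open>The power \<open>\<omega>\<^bsup>-p'\<^esup>\<close> is \<open>\<infinity>\<close> where \<open>\<omega>\<close> vanishes, whence the inverse in \<^typ>\<open>ennreal\<close>.
  Here \<open>p' = p / (p - 1)\<close>.\<close>

definition Apq_const ::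
  "(real ^ 'n \<Rightarrow> real) \<Rightarrow> real \<Rightarrow> real \<Rightarrow> real \<Rightarrow> (real ^ 'n \<Rightarrow> real) \<Rightarrow> ennreal" where
  "Apq_const \<rho> \<theta> p q \<omega> = (SUP (x, r) \<in> UNIV \<times> {0<..}.
     ennreal ((1 + r / \<rho> x) powr (- \<theta>)) *
     ennreal_rpow (nn_avg (ball x r) (\<lambda>y. ennreal (\<omega> y powr q))) (1 / q) *
     (if p = 1 then inverse (ess_inf_on (ball x r) \<omega>)
      else ennreal_rpow
             (nn_avg (ball x r) (\<lambda>y. inverse (ennreal (\<omega> y powr (p / (p - 1)))))) ((p - 1) / p)))"

definition Apq_class ::
  "(real ^ 'n \<Rightarrow> real) \<Rightarrow> real \<Rightarrow> real \<Rightarrow> real \<Rightarrow> (real ^ 'n \<Rightarrow> real) set" where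
  "Apq_class \<rho> \<theta> p q = {\<omega>. weight \<omega> \<and> Apq_const \<rho> \<theta> p q \<omega> < \<infinity>}"

definition Lip_norm ::
  "(real ^ 'n \<Rightarrow> real) \<Rightarrow> real \<Rightarrow> real \<Rightarrow> (real ^ 'n \<Rightarrow> real) \<Rightarrow> ennreal" where
  "Lip_norm \<rho> \<theta> \<beta> f = (SUP (x, r) \<in> UNIV \<times> {0<..}.
     ennreal ((1 + r / \<rho> x) powr (- \<theta>) *
       (1 / measure lebesgue (ball x r) powr (1 + \<beta> / real CARD('n))) *
       (LINT y:ball x r|lebesgue. \<bar>f y - avg (ball x r) f\<bar>)))"

text \<open>Membership and norm depend only on the a.e. class of a function, so no continuous
  representative is singled out.\<close>

definition Lip_space ::
  "(real ^ 'n \<Rightarrow> real) \<Rightarrow> real \<Rightarrow> real \<Rightarrow> (real ^ 'n \<Rightarrow> real) set" where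
  "Lip_space \<rho> \<theta> \<beta> = {f. locally_integrable f \<and> Lip_norm \<rho> \<theta> \<beta> f < \<infinity>}"

definition weighted_osc ::
  "real \<Rightarrow> real \<Rightarrow> (real ^ 'n \<Rightarrow> real) \<Rightarrow> (real ^ 'n \<Rightarrow> real) \<Rightarrow> (real ^ 'n) set \<Rightarrow> ennreal" where
  "weighted_osc q \<beta> \<omega> f B =
     ennreal (1 / measure lebesgue B powr (\<beta> / real CARD('n))) *
     ennreal_rpow
       ((\<integral>\<^sup>+x\<in>B. ennreal (\<bar>f x - avg B f\<bar> powr q * \<omega> x powr q) \<partial>lebesgue) / weight_measure \<omega> q B)
       (1 / q)"

end

theory Submission
  imports Defs
begin

text \<open>
  Write \<open>\<rho>\<close> for the critical radius function.  The two halves rest on different ideas.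

  From the Lipschitz condition to the weighted oscillation, the point is that Campanato regularity
  is a pointwise statement.  For \<open>x\<close> in a ball \<open>B(x\<^sub>0, r)\<close>, the averages of \<open>f\<close> over the balls
  \<open>B(x, 2r/2\<^sup>k)\<close> change from one \<open>k\<close> to the next by at most a multiple of \<open>(2r/2\<^sup>k)\<^sup>\<beta>\<close>, a geometric
  sequence.  Hence the mean of \<open>\<bar>f - c\<bar>\<close>, with \<open>c\<close> the average of \<open>f\<close> over \<open>B(x\<^sub>0, r)\<close>, is at most
  a multiple of \<open>r\<^sup>\<beta>\<close> on all these balls (\<open>small_ball_deviation_le\<close>).  A Vitali covering argument
  turns the bound on small balls into the same bound for \<open>\<bar>f - c\<bar>\<close> almost everywhere
  (\<open>AE_le_if_small_ball_integrals_le\<close>), and a bounded function has a bounded \<open>L\<^sup>q\<close> mean with respect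
  to any weight.  The growth factor is \<open>(1 + 2r/\<rho>(x))\<^sup>\<theta>\<close> at the moving centre \<open>x\<close>; Shen's lower bound
  for \<open>\<rho>(x)/\<rho>(x\<^sub>0)\<close> replaces it by a power of \<open>1 + r/\<rho>(x\<^sub>0)\<close>, and costs the factor \<open>N\<^sub>0 + 1\<close> in the
  exponent (\<open>shen_constants_growth\<close>).

  For the converse, write \<open>a = (a \<omega>) \<omega>\<^sup>-\<^sup>1\<close> for \<open>a = \<bar>f - c\<bar>\<close> and apply Hoelder's inequality for averages
  with the exponents \<open>q\<close> and \<open>p'\<close>, where \<open>1/q + 1/p' \<le> 1\<close> because \<open>p < q\<close>
  (\<open>nn_avg_le_weighted_power_mean\<close>).  The mean of \<open>(a \<omega>)\<^sup>q\<close> is the weighted mean of \<open>a\<^sup>q\<close> times the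
  mean of \<open>\<omega>\<^sup>q\<close>, so the mean of \<open>a\<close> is at most the weighted oscillation times the product of the
  two factors in the \<open>A\<^sub>p\<^sub>,\<^sub>q\<close> constant.  The powers of \<open>1 + r/\<rho>(x)\<close> match exactly, so that the
  constant of the hypothesis is inherited.  Dividing by \<open>\<omega>\<^sup>q(B)\<close> requires this number to be positive
  and finite; \<open>Apq_class_factors_finite\<close> shows that finiteness of the \<open>A\<^sub>p\<^sub>,\<^sub>q\<close> constant forces it.
\<close>

section \<open>Powers of extended nonnegative numbers\<close>

lemma ennreal_rpow_ennreal: "0 \<le> x \<Longrightarrow> ennreal_rpow (ennreal x) a = ennreal (x powr a)"
  by (simp add: ennreal_rpow_def)

lemma ennreal_rpow_mono:
  assumes "x \<le> y" "0 < a"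
  shows "ennreal_rpow x a \<le> ennreal_rpow y a"
proof (cases "y = \<infinity>")
  case False
  then show ?thesis
    using assms by (auto simp: ennreal_rpow_def top_unique less_top
        intro!: ennreal_leI powr_mono2 enn2real_mono)
qed (simp add: ennreal_rpow_def)

lemma ennreal_rpow_eq_0_iff [simp]: "ennreal_rpow x a = 0 \<longleftrightarrow> x = 0"
  by (cases x) (auto simp: ennreal_rpow_def ennreal_eq_0_iff)

lemma ennreal_rpow_eq_top_iff [simp]: "ennreal_rpow x a = top \<longleftrightarrow> x = top"
  by (auto simp: ennreal_rpow_def)

text \<open>This holds also for the products of \<open>0\<close> and \<open>\<infinity>\<close>, which are \<open>0\<close> on
  both sides.\<close>

lemma ennreal_rpow_mult: "ennreal_rpow (x * y) a = ennreal_rpow x a * ennreal_rpow y a"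
proof (cases "x = \<infinity> \<or> y = \<infinity>")
  case True
  then show ?thesis
    by (cases "x = 0 \<or> y = 0")
      (auto simp: ennreal_rpow_def ennreal_mult_top ennreal_top_mult ennreal_eq_0_iff
        ennreal_mult_eq_top_iff enn2real_eq_0_iff)
next
  case False
  then obtain u v where "x = ennreal u" "y = ennreal v" "0 \<le> u" "0 \<le> v"
    by (cases x; cases y) auto
  then show ?thesis
    by (simp add: ennreal_rpow_ennreal powr_mult flip: ennreal_mult)
qed

section \<open>Volumes of balls and averages of nonnegative functions\<close>

lemma emeasure_ball_lebesgue:
  "emeasure lebesgue (ball (x :: real ^ 'n) r) = ennreal (measure lebesgue (ball x r))"
  using lmeasurable_ball by (rule emeasure_eq_measure2)

lemma measure_ball_lebesgue_pos:
  assumes "0 < r"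
  shows "0 < measure lebesgue (ball (x :: real ^ 'n) r)"
  using content_ball_pos[OF assms, of x] by simp

lemma measure_ball_lebesgue:
  assumes "0 \<le> r"
  shows "measure lebesgue (ball (x :: real ^ 'n) r)
    = r ^ CARD('n) * measure lebesgue (ball (0 :: real ^ 'n) 1)"
  using content_ball_conv_unit_ball[OF assms, of x] by simp

lemma measure_ball_powr:
  fixes x :: "real ^ 'n"
  assumes "0 \<le> r"
  shows "measure lebesgue (ball x r) powr (\<beta> / real CARD('n))
    = measure lebesgue (ball (0 :: real ^ 'n) 1) powr (\<beta> / real CARD('n)) * r powr \<beta>"
proof -
  have "(r ^ CARD('n)) powr (\<beta> / real CARD('n)) = r powr \<beta>"
    using assms by (cases "r = 0") (auto simp: powr_powr simp flip: powr_realpow)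
  then show ?thesis
    using assms by (simp add: measure_ball_lebesgue[OF assms, of x] powr_mult)
qed

lemma nn_avg_mono_AE:
  assumes "AE x in lebesgue. x \<in> B \<longrightarrow> g x \<le> h x"
  shows "nn_avg B g \<le> nn_avg B h"
  unfolding nn_avg_def
  by (intro divide_right_mono_ennreal nn_integral_mono_AE)
    (use assms in \<open>auto split: split_indicator\<close>)

lemma nn_avg_cmult:
  assumes "g \<in> borel_measurable lebesgue" "B \<in> sets lebesgue"
  shows "nn_avg B (\<lambda>x. c * g x) = c * nn_avg B g"
  unfolding nn_avg_def using assms
  by (simp add: nn_integral_cmult mult.assoc ennreal_times_divide)

lemma nn_avg_add:
  assumes "g \<in> borel_measurable lebesgue" "h \<in> borel_measurable lebesgue" "B \<in> sets lebesgue"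
  shows "nn_avg B (\<lambda>x. g x + h x) = nn_avg B g + nn_avg B h"
  unfolding nn_avg_def using assms
  by (simp add: nn_integral_add distrib_right add_divide_distrib_ennreal)

lemma nn_avg_const:
  assumes "B \<in> sets lebesgue" "0 < emeasure lebesgue B" "emeasure lebesgue B < \<infinity>"
  shows "nn_avg B (\<lambda>_. c) = c"
proof -
  have "c * emeasure lebesgue B / emeasure lebesgue B = c * (emeasure lebesgue B / emeasure lebesgue B)"
    by (simp add: ennreal_times_divide)
  also have "\<dots> = c" using assms by simp
  finally show ?thesis
    unfolding nn_avg_def using assms by (simp add: nn_integral_cmult_indicator)
qed

lemma nn_avg_eq_0_iff:
  assumes "g \<in> borel_measurable lebesgue" "B \<in> sets lebesgue" "emeasure lebesgue B < \<infinity>"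
  shows "nn_avg B g = 0 \<longleftrightarrow> (AE x in lebesgue. x \<in> B \<longrightarrow> g x = 0)"
proof -
  have "nn_avg B g = 0 \<longleftrightarrow> (\<integral>\<^sup>+x\<in>B. g x \<partial>lebesgue) = 0"
    using assms by (auto simp: nn_avg_def ennreal_divide_eq_0_iff)
  also have "\<dots> \<longleftrightarrow> (AE x in lebesgue. g x * indicator B x = 0)"
    using assms by (intro nn_integral_0_iff_AE) auto
  also have "\<dots> \<longleftrightarrow> (AE x in lebesgue. x \<in> B \<longrightarrow> g x = 0)"
    by (intro AE_cong) (auto split: split_indicator)
  finally show ?thesis .
qed

section \<open>Hoelder's inequality for averages\<close>

text \<open>Weighted arithmetic-geometric mean inequality for \<open>u\<close>, \<open>v\<close> and \<open>1\<close>, the latter with the weight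
  \<open>1 - a - b\<close>.  With \<open>g\<close> the left-hand side it follows from \<open>ln z \<le> z - 1\<close> at \<open>u/g\<close>, \<open>v/g\<close>
  and \<open>1/g\<close>, since the weighted sum of the three logarithms vanishes.\<close>

lemma young_three_terms:
  fixes u v a b :: real
  assumes "0 < u" "0 < v" "0 < a" "0 < b" "a + b \<le> 1"
  shows "u powr a * v powr b \<le> a * u + b * v + (1 - a - b)"
proof -
  define g where "g = u powr a * v powr b"
  have g: "0 < g" using assms by (simp add: g_def)
  have lng: "ln g = a * ln u + b * ln v"
    using assms by (simp add: g_def ln_mult ln_powr)
  have 1: "ln u - ln g \<le> u / g - 1" "ln v - ln g \<le> v / g - 1" "- ln g \<le> 1 / g - 1"
    using ln_le_minus_one[of "u / g"] ln_le_minus_one[of "v / g"] ln_le_minus_one[of "1 / g"] g assms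
    by (auto simp: ln_div)
  have "a * (ln u - ln g) + b * (ln v - ln g) + (1 - a - b) * (- ln g)
      \<le> a * (u / g - 1) + b * (v / g - 1) + (1 - a - b) * (1 / g - 1)"
    using 1 assms by (intro add_mono mult_left_mono) auto
  moreover have "a * (ln u - ln g) + b * (ln v - ln g) + (1 - a - b) * (- ln g) = 0"
    using lng by (simp add: algebra_simps)
  moreover have "a * (u / g - 1) + b * (v / g - 1) + (1 - a - b) * (1 / g - 1)
      = (a * u + b * v + (1 - a - b)) / g - 1"
    using g by (simp add: field_simps)
  ultimately have "1 \<le> (a * u + b * v + (1 - a - b)) / g" by linarith
  then show ?thesis using g by (simp add: g_def field_simps)
qed

text \<open>Averaging allows \<open>1/q + 1/s < 1\<close>: the constant function \<open>1\<close>, whose mean is \<open>1\<close>, takes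
  the remaining weight in the three-term Young inequality.  That inequality is applied to \<open>g\<^sup>q\<close> and
  \<open>h\<^sup>s\<close> divided by their means, and averaged.\<close>

lemma nn_avg_hoelder:
  fixes g h :: "real ^ 'n \<Rightarrow> real"
  assumes g: "g \<in> borel_measurable lebesgue" "\<And>x. 0 \<le> g x"
    and h: "h \<in> borel_measurable lebesgue" "\<And>x. 0 \<le> h x"
    and B: "B \<in> sets lebesgue" "0 < emeasure lebesgue B" "emeasure lebesgue B < \<infinity>"
    and qs: "0 < q" "0 < s" "1 / q + 1 / s \<le> 1"
  shows "nn_avg B (\<lambda>x. ennreal (g x * h x))
    \<le> ennreal_rpow (nn_avg B (\<lambda>x. ennreal (g x powr q))) (1 / q)
      * ennreal_rpow (nn_avg B (\<lambda>x. ennreal (h x powr s))) (1 / s)"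
proof -
  define X where "X = nn_avg B (\<lambda>x. ennreal (g x powr q))"
  define Y where "Y = nn_avg B (\<lambda>x. ennreal (h x powr s))"
  note [measurable] = g(1) h(1)
  have gq: "(\<lambda>x. ennreal (g x powr q)) \<in> borel_measurable lebesgue"
    and hs: "(\<lambda>x. ennreal (h x powr s)) \<in> borel_measurable lebesgue"
    and gh: "(\<lambda>x. ennreal (g x * h x)) \<in> borel_measurable lebesgue" by measurable
  have "nn_avg B (\<lambda>x. ennreal (g x * h x)) \<le> ennreal_rpow X (1 / q) * ennreal_rpow Y (1 / s)"
  proof (cases "X = 0 \<or> Y = 0")
    case True
    then have "AE x in lebesgue. x \<in> B \<longrightarrow> ennreal (g x * h x) = 0"
    proof
      assume "X = 0"
      then have "AE x in lebesgue. x \<in> B \<longrightarrow> ennreal (g x powr q) = 0"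
        using nn_avg_eq_0_iff[OF gq B(1,3)] by (simp add: X_def)
      then show ?thesis by eventually_elim (auto simp: ennreal_eq_0_iff)
    next
      assume "Y = 0"
      then have "AE x in lebesgue. x \<in> B \<longrightarrow> ennreal (h x powr s) = 0"
        using nn_avg_eq_0_iff[OF hs B(1,3)] by (simp add: Y_def)
      then show ?thesis by eventually_elim (auto simp: ennreal_eq_0_iff)
    qed
    then show ?thesis using nn_avg_eq_0_iff[OF gh B(1,3)] by simp
  next
    case nz: False
    show ?thesis
    proof (cases "X = \<infinity> \<or> Y = \<infinity>")
      case True
      have "ennreal_rpow X (1 / q) * ennreal_rpow Y (1 / s) = \<infinity>"
        using True nz
        by (metis ennreal_mult_eq_top_iff ennreal_rpow_eq_0_iff ennreal_rpow_eq_top_iff infinity_ennreal_def)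
      then show ?thesis by simp
    next
      case False
      with nz obtain \<xi> \<eta> where X: "X = ennreal \<xi>" "0 < \<xi>" and Y: "Y = ennreal \<eta>" "0 < \<eta>"
        by (cases X; cases Y) (auto simp: less_le)
      \<comment> \<open>The claimed bound; the pointwise estimate \<open>pt\<close> averages to exactly this number.\<close>
      define c where "c = \<xi> powr (1 / q) * \<eta> powr (1 / s)"
      have c: "0 < c" using X Y by (simp add: c_def)
      define \<kappa> where "\<kappa> = 1 - 1 / q - 1 / s"
      have \<kappa>: "0 \<le> \<kappa>" using qs by (simp add: \<kappa>_def)
      have pt: "g x * h x \<le> c * (1 / (q * \<xi>)) * g x powr q + c * (1 / (s * \<eta>)) * h x powr s + c * \<kappa>" for x
      proof (cases "g x = 0 \<or> h x = 0")
        case True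
        then show ?thesis using c \<kappa> qs X Y by (auto intro!: add_nonneg_nonneg)
      next
        case False
        then have pos: "0 < g x" "0 < h x" using g(2)[of x] h(2)[of x] by auto
        have "(g x powr q / \<xi>) powr (1 / q) * (h x powr s / \<eta>) powr (1 / s)
            \<le> (1 / q) * (g x powr q / \<xi>) + (1 / s) * (h x powr s / \<eta>) + (1 - 1 / q - 1 / s)"
          using pos X Y qs by (intro young_three_terms) auto
        moreover have "(g x powr q / \<xi>) powr (1 / q) * (h x powr s / \<eta>) powr (1 / s) = g x * h x / c"
          using pos X Y qs by (simp add: c_def powr_divide powr_powr)
        ultimately have "g x * h x / c \<le> (1 / q) * (g x powr q / \<xi>) + (1 / s) * (h x powr s / \<eta>) + \<kappa>"
          by (simp add: \<kappa>_def)
        then have "g x * h x \<le> c * ((1 / q) * (g x powr q / \<xi>) + (1 / s) * (h x powr s / \<eta>) + \<kappa>)"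
          using c by (simp add: pos_divide_le_eq mult.commute)
        then show ?thesis by (simp add: algebra_simps)
      qed
      define k1 where "k1 = c * (1 / (q * \<xi>))"
      define k2 where "k2 = c * (1 / (s * \<eta>))"
      have k: "0 \<le> k1" "0 \<le> k2" "0 \<le> c * \<kappa>" using c qs X Y \<kappa> by (auto simp: k1_def k2_def)
      have "nn_avg B (\<lambda>x. ennreal (g x * h x))
          \<le> nn_avg B (\<lambda>x. (ennreal k1 * ennreal (g x powr q) + ennreal k2 * ennreal (h x powr s))
              + ennreal (c * \<kappa>))"
        using k pt[folded k1_def k2_def]
        by (intro nn_avg_mono_AE AE_I2) (simp add: ennreal_leI flip: ennreal_plus ennreal_mult)
      also have "\<dots> = ennreal k1 * X + ennreal k2 * Y + ennreal (c * \<kappa>)"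
        using B by (simp add: nn_avg_add nn_avg_cmult nn_avg_const X_def Y_def)
      also have "\<dots> = ennreal (k1 * \<xi> + k2 * \<eta> + c * \<kappa>)"
        using k X Y by (simp add: ennreal_mult ennreal_plus)
      also have "k1 * \<xi> + k2 * \<eta> + c * \<kappa> = c"
        using qs X Y by (simp add: k1_def k2_def \<kappa>_def field_simps)
      also have "ennreal c = ennreal_rpow X (1 / q) * ennreal_rpow Y (1 / s)"
        using X Y by (simp add: c_def ennreal_rpow_ennreal ennreal_mult)
      finally show ?thesis .
    qed
  qed
  then show ?thesis by (simp add: X_def Y_def)
qed

section \<open>Locally integrable functions and their averages\<close>

lemma locally_integrable_ball:
  assumes "locally_integrable (f :: real ^ 'n \<Rightarrow> real)"
  shows "set_integrable lebesgue (ball x r) f"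
  using assms unfolding locally_integrable_def
  by (rule set_integrable_subset[OF allE[of _ "cball x r"]]) auto

lemma locally_integrable_measurable:
  assumes "locally_integrable (f :: real ^ 'n \<Rightarrow> real)"
  shows "f \<in> borel_measurable lebesgue"
proof (rule borel_measurable_LIMSEQ_real)
  show "(\<lambda>x. indicator (ball 0 (real n)) x *\<^sub>R f x) \<in> borel_measurable lebesgue" for n
    using locally_integrable_ball[OF assms, of 0 "real n"]
    unfolding set_integrable_def by (rule borel_measurable_integrable)
  show "(\<lambda>n. indicator (ball 0 (real n)) x *\<^sub>R f x) \<longlonglongrightarrow> f x" for x
  proof (rule tendsto_eventually)
    obtain k where k: "norm x < real k" using reals_Archimedean2 by blast
    show "\<forall>\<^sub>F n in sequentially. indicator (ball 0 (real n)) x *\<^sub>R f x = f x"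
      using eventually_ge_at_top[of k] by eventually_elim (use k in auto)
  qed
qed

lemma set_integrable_const_ball:
  "set_integrable lebesgue (ball (x :: real ^ 'n) r) (\<lambda>_. c :: real)"
  unfolding set_integrable_def using lmeasurable_ball[of x r]
  by (auto simp: fmeasurable_def intro!: integrable_scaleR_left integrable_real_indicator)

lemma integrable_abs_diff_const_ball:
  assumes "locally_integrable (f :: real ^ 'n \<Rightarrow> real)"
  shows "set_integrable lebesgue (ball x r) (\<lambda>y. \<bar>f y - c\<bar>)"
  using locally_integrable_ball[OF assms] set_integrable_const_ball
  by (intro set_integrable_abs set_integral_diff)

lemma nn_integral_abs_diff_const_ball:
  assumes "locally_integrable (f :: real ^ 'n \<Rightarrow> real)"
  shows "(\<integral>\<^sup>+y\<in>ball x r. ennreal \<bar>f y - c\<bar> \<partial>lebesgue)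
    = ennreal (LINT y:ball x r|lebesgue. \<bar>f y - c\<bar>)"
proof -
  have "(\<integral>\<^sup>+y\<in>ball x r. ennreal \<bar>f y - c\<bar> \<partial>lebesgue)
      = (\<integral>\<^sup>+y. ennreal (indicator (ball x r) y *\<^sub>R \<bar>f y - c\<bar>) \<partial>lebesgue)"
    by (intro nn_integral_cong) (auto split: split_indicator)
  also have "\<dots> = ennreal (LINT y|lebesgue. indicator (ball x r) y *\<^sub>R \<bar>f y - c\<bar>)"
    using integrable_abs_diff_const_ball[OF assms]
    by (intro nn_integral_eq_integral) (auto simp: set_integrable_def)
  finally show ?thesis by (simp add: set_lebesgue_integral_def)
qed

text \<open>The usual way to compare averages over nested balls: the loss is the ratio of the volumes,
  which is bounded for balls of comparable radii.\<close>

lemma avg_minus_const_le: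
  fixes f :: "real ^ 'n \<Rightarrow> real"
  assumes f: "locally_integrable f" and "0 < r" and sub: "ball x r \<subseteq> ball y s"
  shows "\<bar>avg (ball x r) f - c\<bar>
    \<le> (LINT z:ball y s|lebesgue. \<bar>f z - c\<bar>) / measure lebesgue (ball x r)"
proof -
  have pos: "0 < measure lebesgue (ball x r)" using measure_ball_lebesgue_pos[OF \<open>0 < r\<close>] .
  note ci = set_integrable_const_ball[of x r c]
  have "(LINT z:ball x r|lebesgue. f z - c)
      = (LINT z:ball x r|lebesgue. f z) - c * measure lebesgue (ball x r)"
    using locally_integrable_ball[OF f] ci
    by (subst set_integral_diff) (simp_all add: set_lebesgue_integral_def)
  then have "\<bar>avg (ball x r) f - c\<bar> = \<bar>LINT z:ball x r|lebesgue. f z - c\<bar> / measure lebesgue (ball x r)"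
    using pos by (simp add: avg_def field_simps)
  also have "\<bar>LINT z:ball x r|lebesgue. f z - c\<bar> \<le> (LINT z:ball x r|lebesgue. \<bar>f z - c\<bar>)"
    using set_integral_norm_bound[of lebesgue "ball x r" "\<lambda>z. f z - c"]
      locally_integrable_ball[OF f] ci by (simp add: set_integral_diff)
  also have "\<dots> \<le> (LINT z:ball y s|lebesgue. \<bar>f z - c\<bar>)"
    unfolding set_lebesgue_integral_def
    using integrable_abs_diff_const_ball[OF f] sub
    by (intro integral_mono) (auto simp: set_integrable_def split: split_indicator)
  finally show ?thesis using pos by (simp add: divide_right_mono)
qed

section \<open>Pointwise bounds from averages over small balls\<close>

text \<open>This takes the place of the Lebesgue differentiation theorem.  If \<open>g > M + e\<close> on a set \<open>E\<close> of
  positive measure, cover almost all of \<open>E\<close> by disjoint balls on which the mean of \<open>g\<close> is at most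
  \<open>M\<close>, inside an open set \<open>T\<close> with \<open>\<bar>T\<bar> < \<bar>E\<bar> + \<delta>\<close>.  Then
  \<open>(M + e) \<bar>E\<bar> \<le> M (\<bar>E\<bar> + \<delta>)\<close>, which is false for small \<open>\<delta>\<close>.\<close>

lemma AE_le_if_small_ball_integrals_le:
  fixes g :: "'a :: euclidean_space \<Rightarrow> ennreal"
  assumes g: "g \<in> borel_measurable lebesgue"
    and S: "S \<in> lmeasurable" and M: "0 \<le> M"
    and small: "\<And>x d. x \<in> S \<Longrightarrow> 0 < d \<Longrightarrow> \<exists>r. 0 < r \<and> r < d \<and>
      (\<integral>\<^sup>+y\<in>ball x r. g y \<partial>lebesgue) \<le> ennreal M * emeasure lebesgue (ball x r)"
  shows "AE x in lebesgue. x \<in> S \<longrightarrow> g x \<le> ennreal M"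
proof -
  note [measurable] = g
  have Sset[measurable]: "S \<in> sets lebesgue" using S by auto
  define E where "E e = {x \<in> space lebesgue. x \<in> S \<and> ennreal (M + e) < g x}" for e :: real
  have Eset: "E e \<in> sets lebesgue" for e unfolding E_def by measurable
  have null: "emeasure lebesgue (E e) = 0" if e: "0 < e" for e
  proof -
    have "E e \<in> lmeasurable"
      by (rule fmeasurableI2[OF S _ Eset]) (auto simp: E_def)
    then obtain m where m: "emeasure lebesgue (E e) = ennreal m" "0 \<le> m"
      by (auto simp: emeasure_eq_measure2)
    have "e * m \<le> 0"
    proof (rule field_le_epsilon)
      fix \<epsilon> :: real assume \<epsilon>: "0 < \<epsilon>"
      \<comment> \<open>The denominator is \<open>M + 1\<close> rather than \<open>M\<close> because \<open>M\<close> may be \<open>0\<close>.\<close>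
      define \<delta> where "\<delta> = \<epsilon> / (M + 1)"
      have \<delta>: "0 < \<delta>" "M * \<delta> \<le> \<epsilon>" using \<epsilon> M by (auto simp: \<delta>_def field_simps)
      obtain T where T: "open T" "E e \<subseteq> T" "T - E e \<in> lmeasurable" "emeasure lebesgue (T - E e) < ennreal \<delta>"
        using sets_lebesgue_outer_open[OF Eset \<delta>(1)] by blast
      define K where "K = {(x, r). x \<in> E e \<and> 0 < r \<and> ball x r \<subseteq> T \<and>
        (\<integral>\<^sup>+y\<in>ball x r. g y \<partial>lebesgue) \<le> ennreal M * emeasure lebesgue (ball x r)}"
      have cover: "\<exists>i. i \<in> K \<and> x \<in> ball (fst i) (snd i) \<and> snd i < d" if xd: "x \<in> E e" "0 < d" for x d
      proof -
        obtain d' where d': "0 < d'" "ball x d' \<subseteq> T"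
          using T(1,2) \<open>x \<in> E e\<close> by (meson open_contains_ball subsetD)
        obtain r where "0 < r" "r < min d d'"
          "(\<integral>\<^sup>+y\<in>ball x r. g y \<partial>lebesgue) \<le> ennreal M * emeasure lebesgue (ball x r)"
          using small[of x "min d d'"] xd d' by (auto simp: E_def)
        moreover from this d' have "ball x r \<subseteq> T" by (meson min.strict_boundedE less_imp_le subset_ball order_trans)
        ultimately show ?thesis
          using that by (intro exI[of _ "(x, r)"]) (auto simp: K_def)
      qed
      obtain D where D: "countable D" "D \<subseteq> K"
        "pairwise (\<lambda>i j. disjnt (ball (fst i) (snd i)) (ball (fst j) (snd j))) D"
        "negligible (E e - (\<Union>i\<in>D. ball (fst i) (snd i)))"
        using Vitali_covering_theorem_balls[where S = "E e" and a = fst and r = snd and K = K, OF cover]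
        by blast
      define U where "U = (\<Union>i\<in>D. ball (fst i) (snd i))"
      have dis: "disjoint_family_on (\<lambda>i. ball (fst i) (snd i)) D"
        using D(3) by (auto simp: disjoint_family_on_def pairwise_def disjnt_def)
      have "ball (fst i) (snd i) \<subseteq> T" if "i \<in> D" for i
        using subsetD[OF D(2) that] by (simp add: K_def case_prod_beta)
      then have UT: "U \<subseteq> T" unfolding U_def by blast
      have U: "U \<in> sets lebesgue" unfolding U_def using D(1) by auto
      have "ennreal ((M + e) * m) = (\<integral>\<^sup>+x. ennreal (M + e) * indicator (E e) x \<partial>lebesgue)"
        using M e m Eset by (simp add: nn_integral_cmult_indicator ennreal_mult)
      also have "\<dots> \<le> (\<integral>\<^sup>+x\<in>U. g x \<partial>lebesgue)"
      proof (intro nn_integral_mono_AE)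
        have "AE x in lebesgue. x \<notin> E e - U"
          using D(4) by (intro AE_not_in) (simp add: U_def negligible_iff_null_sets)
        then show "AE x in lebesgue. ennreal (M + e) * indicator (E e) x \<le> g x * indicator U x"
          by eventually_elim (auto simp: E_def split: split_indicator)
      qed
      \<comment> \<open>Countable additivity of the measure with density \<open>g\<close> splits the integral into balls.\<close>
      also have "\<dots> = emeasure (density lebesgue g) U"
        using U by (simp add: emeasure_density)
      also have "\<dots> = (\<integral>\<^sup>+i. emeasure (density lebesgue g) (ball (fst i) (snd i)) \<partial>count_space D)"
        unfolding U_def using D(1) dis by (intro emeasure_UN_countable) auto
      also have "\<dots> \<le> (\<integral>\<^sup>+i. ennreal M * emeasure lebesgue (ball (fst i) (snd i)) \<partial>count_space D)"
        using D(2) by (intro nn_integral_mono) (auto simp: emeasure_density K_def)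
      also have "\<dots> = ennreal M * (\<integral>\<^sup>+i. emeasure lebesgue (ball (fst i) (snd i)) \<partial>count_space D)"
        by (simp add: nn_integral_cmult)
      also have "(\<integral>\<^sup>+i. emeasure lebesgue (ball (fst i) (snd i)) \<partial>count_space D) = emeasure lebesgue U"
        unfolding U_def using D(1) dis by (intro emeasure_UN_countable[symmetric]) auto
      also have "emeasure lebesgue U \<le> emeasure lebesgue (E e \<union> (T - E e))"
        using UT by (intro emeasure_mono sets.Un Eset fmeasurableD[OF T(3)]) auto
      also have "\<dots> \<le> emeasure lebesgue (E e) + emeasure lebesgue (T - E e)"
        using T Eset by (intro emeasure_subadditive) auto
      also have "\<dots> \<le> ennreal (m + \<delta>)"
        using T m \<delta> by (auto simp: ennreal_plus intro!: add_mono)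
      finally have "ennreal ((M + e) * m) \<le> ennreal (M * (m + \<delta>))"
        using M m \<delta> by (simp add: ennreal_mult mult_left_mono)
      then have "(M + e) * m \<le> M * (m + \<delta>)"
        using M m \<delta> by (subst (asm) ennreal_le_iff) auto
      then show "e * m \<le> 0 + \<epsilon>" using \<delta> by (simp add: algebra_simps)
    qed
    then have "m = 0" using e m by (simp add: mult_le_0_iff)
    then show ?thesis using m by simp
  qed
  have "AE x in lebesgue. x \<notin> E (1 / Suc n)" for n
    using null[of "1 / Suc n"] Eset by (intro AE_not_in) (auto simp: null_sets_def)
  then have "AE x in lebesgue. \<forall>n. x \<notin> E (1 / Suc n)" by (simp add: AE_all_countable)
  then show ?thesis
  proof eventually_elim
    case (elim x)
    show ?case
    proof (rule impI, rule ennreal_le_epsilon)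
      fix e :: real assume "x \<in> S" "0 < e"
      obtain n where n: "1 / real (Suc n) < e" using \<open>0 < e\<close> by (rule nat_approx_posE)
      have "g x \<le> ennreal (M + 1 / Suc n)"
        using elim \<open>x \<in> S\<close> by (auto simp: E_def not_less)
      also have "\<dots> \<le> ennreal M + ennreal e"
        using M n by (subst ennreal_plus) (auto intro!: add_left_mono ennreal_leI)
      finally show "g x \<le> ennreal M + ennreal e" .
    qed
  qed
qed

section \<open>From the Lipschitz condition to the weighted oscillation\<close>

text \<open>Telescoping over the balls \<open>B(x, 2r/2\<^sup>k)\<close>.  The radii start at \<open>2r\<close> so that the first of them
  contains \<open>B(x\<^sub>0, r)\<close>, whose radius is half as large; each step, like this comparison with
  \<open>B(x\<^sub>0, r)\<close>, loses the ratio \<open>2\<^sup>d\<close> of the volumes.  The steps decay like \<open>t\<^sup>k\<close> with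
  \<open>t = 2\<^sup>-\<^sup>\<beta> < 1\<close> and sum to at most \<open>1/(1 - t)\<close>.  Of the summand \<open>2\<close> in the constant, one unit
  is the comparison with \<open>B(x\<^sub>0, r)\<close> and the other the oscillation on the ball itself.\<close>

lemma small_ball_deviation_le:
  fixes f :: "real ^ 'n \<Rightarrow> real"
  assumes f: "locally_integrable f" and \<beta>: "0 < \<beta>" and r: "0 < r" and \<Lambda>: "0 \<le> \<Lambda>"
    and x: "x \<in> ball x\<^sub>0 r"
    and osc: "\<And>s. 0 < s \<Longrightarrow> s \<le> 2 * r \<Longrightarrow>
      (LINT y:ball x s|lebesgue. \<bar>f y - avg (ball x s) f\<bar>)
        \<le> \<Lambda> * s powr \<beta> * measure lebesgue (ball x s)"
  defines "t \<equiv> 2 powr (- \<beta>)"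
  shows "(LINT y:ball x (2 * r / 2 ^ k)|lebesgue. \<bar>f y - avg (ball x\<^sub>0 r) f\<bar>)
    \<le> 2 ^ CARD('n) * (2 + 1 / (1 - t)) * \<Lambda> * (2 * r) powr \<beta>
        * measure lebesgue (ball x (2 * r / 2 ^ k))"
proof -
  define c where "c = avg (ball x\<^sub>0 r) f"
  define s where "s k = 2 * r / 2 ^ k" for k :: nat
  define B where "B k = ball x (s k)" for k
  define A where "A = \<Lambda> * (2 * r) powr \<beta>"
  define d :: real where "d = 2 ^ CARD('n)"
  have t: "0 < t" "t < 1" using \<beta> by (auto simp: t_def powr_less_one)
  have A: "0 \<le> A" using \<Lambda> by (simp add: A_def)
  have d: "1 \<le> d" by (simp add: d_def)
  have s: "0 < s k" "s k \<le> 2 * r" for k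
    using r by (auto simp: s_def divide_le_eq)
  have s_powr: "\<Lambda> * s k powr \<beta> = A * t ^ k" for k
  proof -
    have "(2 ^ k) powr \<beta> = (2 powr \<beta>) ^ k"
      by (simp add: powr_powr mult.commute flip: powr_realpow)
    then have "s k powr \<beta> = (2 * r) powr \<beta> / (2 powr \<beta>) ^ k"
      unfolding s_def using r by (subst powr_divide) auto
    then show ?thesis
      by (simp add: A_def t_def powr_minus power_inverse divide_inverse)
  qed
  have osc': "(LINT y:B k|lebesgue. \<bar>f y - avg (B k) f\<bar>) \<le> A * t ^ k * measure lebesgue (B k)" for k
    using osc[OF s, of k] by (simp add: B_def s_powr)
  have half: "measure lebesgue (B k) = d * measure lebesgue (ball z (s k / 2))" for k and z :: "real ^ 'n"
    using s[of k] measure_ball_lebesgue[of "s k" x] measure_ball_lebesgue[of "s k / 2" z]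
    by (simp add: B_def d_def power_divide)
  \<comment> \<open>Applied with \<open>z = x\<^sub>0\<close> for the comparison with \<open>B(x\<^sub>0, r)\<close>, and with \<open>z = x\<close> for the steps.\<close>
  have jump: "\<bar>avg (ball z (s k / 2)) f - avg (B k) f\<bar> \<le> d * (A * t ^ k)"
    if "ball z (s k / 2) \<subseteq> B k" for z :: "real ^ 'n" and k
  proof -
    have "\<bar>avg (ball z (s k / 2)) f - avg (B k) f\<bar>
        \<le> (LINT y:B k|lebesgue. \<bar>f y - avg (B k) f\<bar>) / measure lebesgue (ball z (s k / 2))"
      using that s[of k] unfolding B_def by (intro avg_minus_const_le[OF f]) auto
    also have "\<dots> \<le> (A * t ^ k * measure lebesgue (B k)) / measure lebesgue (ball z (s k / 2))"
      by (intro divide_right_mono osc') auto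
    also have "\<dots> = d * (A * t ^ k)"
      using measure_ball_lebesgue_pos[of "s k / 2" z] s[of k] by (simp add: half[of k z])
    finally show ?thesis .
  qed
  have tele: "\<bar>avg (B k) f - c\<bar> \<le> d * A * (1 + (\<Sum>j<k. t ^ j))" for k
  proof (induction k)
    case 0
    have "ball x\<^sub>0 r \<subseteq> B 0"
      using x by (auto simp: B_def s_def) (smt (verit) dist_commute dist_triangle)
    then show ?case
      using jump[of x\<^sub>0 0] by (simp add: s_def c_def abs_minus_commute)
  next
    case (Suc k)
    have "B (Suc k) = ball x (s k / 2)" by (simp add: B_def s_def)
    then have "\<bar>avg (B (Suc k)) f - avg (B k) f\<bar> \<le> d * (A * t ^ k)"
      using jump[of x k] s[of k] by (simp add: B_def subset_ball)
    then show ?case using Suc by (simp add: algebra_simps)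
  qed
  have geo: "(\<Sum>j<k. t ^ j) \<le> 1 / (1 - t)" for k
    using t by (simp add: sum_gp_strict divide_right_mono)
  have dev: "\<bar>avg (B k) f - c\<bar> \<le> d * A * (1 + 1 / (1 - t))"
    using tele[of k] geo[of k] d A
    by (meson add_left_mono mult_left_mono mult_nonneg_nonneg order_trans zero_le_one)
  have "(LINT y:B k|lebesgue. \<bar>f y - c\<bar>)
      \<le> (LINT y:B k|lebesgue. \<bar>f y - avg (B k) f\<bar> + \<bar>avg (B k) f - c\<bar>)"
  proof (rule set_integral_mono)
    show "set_integrable lebesgue (B k) (\<lambda>y. \<bar>f y - avg (B k) f\<bar> + \<bar>avg (B k) f - c\<bar>)"
      using integrable_abs_diff_const_ball[OF f] set_integrable_const_ball
      unfolding B_def by (intro set_integral_add)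
  qed (use integrable_abs_diff_const_ball[OF f] in \<open>auto simp: B_def\<close>)
  also have "\<dots> = (LINT y:B k|lebesgue. \<bar>f y - avg (B k) f\<bar>)
      + \<bar>avg (B k) f - c\<bar> * measure lebesgue (B k)"
    using integrable_abs_diff_const_ball[OF f] set_integrable_const_ball
    by (subst set_integral_add) (auto simp: B_def set_lebesgue_integral_def)
  also have "\<dots> \<le> A * t ^ k * measure lebesgue (B k)
      + d * A * (1 + 1 / (1 - t)) * measure lebesgue (B k)"
    by (intro add_mono mult_right_mono osc' dev) auto
  also have "\<dots> \<le> d * A * measure lebesgue (B k)
      + d * A * (1 + 1 / (1 - t)) * measure lebesgue (B k)"
  proof -
    have "A * t ^ k \<le> A * 1" using t A by (intro mult_left_mono power_le_one) auto
    also have "\<dots> \<le> d * A" using d A by (simp add: mult_le_cancel_right1)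
    finally show ?thesis by (intro add_right_mono mult_right_mono) auto
  qed
  finally show ?thesis
    by (simp add: B_def s_def c_def A_def d_def algebra_simps)
qed

lemma critical_radius_nonneg: "0 \<le> critical_radius V x"
  by (simp add: critical_radius_def)

text \<open>A zero of the critical radius would make all quotients in Shen's estimate \<open>0\<close>, because
  \<open>a / 0 = 0\<close>; at equal points the lower bound would then read \<open>1/C\<^sub>0 \<le> 0\<close>.\<close>

lemma shen_constants_imp_pos:
  assumes "shen_constants (critical_radius V) C\<^sub>0 N\<^sub>0"
  shows "0 < critical_radius V x"
proof -
  have "critical_radius V x \<noteq> 0"
  proof
    assume "critical_radius V x = 0"
    moreover have "1 / C\<^sub>0 * (1 + dist x x / critical_radius V x) powr (- N\<^sub>0)
        \<le> critical_radius V x / critical_radius V x" "1 \<le> C\<^sub>0"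
      using assms unfolding shen_constants_def by blast+
    ultimately show False by (simp add: divide_le_0_iff)
  qed
  with critical_radius_nonneg[of V x] show ?thesis by linarith
qed

text \<open>The growth factor at a point \<open>x\<close> of the ball is controlled by the one at its centre: Shen's
  lower bound gives \<open>r/\<rho>(x) \<le> C\<^sub>0 (1 + r/\<rho>(x\<^sub>0))\<^bsup>N\<^sub>0\<^esup> r/\<rho>(x\<^sub>0)\<close>, and the last quotient supplies one
  more power of \<open>1 + r/\<rho>(x\<^sub>0)\<close>.\<close>

lemma shen_constants_growth:
  fixes \<rho> :: "real ^ 'n \<Rightarrow> real"
  assumes "shen_constants \<rho> C\<^sub>0 N\<^sub>0" and pos: "0 < \<rho> x" "0 < \<rho> x\<^sub>0" and x: "dist x\<^sub>0 x < r"
  shows "1 + 2 * r / \<rho> x \<le> (2 * C\<^sub>0 + 1) * (1 + r / \<rho> x\<^sub>0) powr (N\<^sub>0 + 1)"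
proof -
  have C0: "1 \<le> C\<^sub>0" "0 < N\<^sub>0"
    and cmp: "1 / C\<^sub>0 * (1 + dist x\<^sub>0 x / \<rho> x\<^sub>0) powr (- N\<^sub>0) \<le> \<rho> x / \<rho> x\<^sub>0"
    using assms(1) by (auto simp: shen_constants_def)
  have r: "0 < r" using x by (rule order_le_less_trans[OF zero_le_dist])
  define a where "a = 1 + dist x\<^sub>0 x / \<rho> x\<^sub>0"
  define b where "b = 1 + r / \<rho> x\<^sub>0"
  have ab: "1 \<le> a" "a \<le> b" using x pos by (auto simp: a_def b_def divide_right_mono)
  have "\<rho> x\<^sub>0 \<le> C\<^sub>0 * a powr N\<^sub>0 * \<rho> x"
    using cmp pos C0 ab by (simp add: a_def[symmetric] powr_minus field_simps)
  also have "\<dots> \<le> C\<^sub>0 * b powr N\<^sub>0 * \<rho> x"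
    using ab C0 pos by (intro mult_left_mono mult_right_mono powr_mono2) auto
  finally have "1 / \<rho> x \<le> C\<^sub>0 * b powr N\<^sub>0 / \<rho> x\<^sub>0"
    using pos by (simp add: field_simps)
  then have "2 * r * (1 / \<rho> x) \<le> 2 * r * (C\<^sub>0 * b powr N\<^sub>0 / \<rho> x\<^sub>0)"
    using r by (intro mult_left_mono) auto
  also have "\<dots> = 2 * C\<^sub>0 * (b powr N\<^sub>0 * (b - 1))" by (simp add: b_def)
  also have "\<dots> \<le> 2 * C\<^sub>0 * (b powr N\<^sub>0 * b)"
    using C0 by (intro mult_left_mono) auto
  also have "b powr N\<^sub>0 * b = b powr (N\<^sub>0 + 1)" using ab by (simp add: powr_add)
  finally have "2 * r / \<rho> x \<le> 2 * C\<^sub>0 * b powr (N\<^sub>0 + 1)" by simp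
  moreover have "1 \<le> b powr (N\<^sub>0 + 1)" using ab C0 by (intro ge_one_powr_ge_zero) auto
  ultimately show ?thesis unfolding b_def by (simp add: algebra_simps)
qed

lemma Lip_norm_osc_le:
  fixes f :: "real ^ 'n \<Rightarrow> real"
  assumes fin: "Lip_norm \<rho> \<theta> \<beta> f < \<infinity>" and r: "0 < r" and \<rho>: "0 \<le> \<rho> x"
  shows "(LINT y:ball x r|lebesgue. \<bar>f y - avg (ball x r) f\<bar>)
    \<le> enn2real (Lip_norm \<rho> \<theta> \<beta> f) * (1 + r / \<rho> x) powr \<theta>
      * measure lebesgue (ball x r) powr (\<beta> / real CARD('n)) * measure lebesgue (ball x r)"
proof -
  define I where "I = (LINT y:ball x r|lebesgue. \<bar>f y - avg (ball x r) f\<bar>)"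
  define m where "m = measure lebesgue (ball x r)"
  define w where "w = 1 + r / \<rho> x"
  have m: "0 < m" unfolding m_def by (rule measure_ball_lebesgue_pos[OF r])
  have w: "1 \<le> w" using \<rho> r by (simp add: w_def)
  have "ennreal (w powr (- \<theta>) * (1 / m powr (1 + \<beta> / real CARD('n))) * I) \<le> Lip_norm \<rho> \<theta> \<beta> f"
    unfolding Lip_norm_def I_def m_def w_def using r
    by (intro SUP_upper2[of "(x, r)"]) auto
  then have "w powr (- \<theta>) * (1 / m powr (1 + \<beta> / real CARD('n))) * I \<le> enn2real (Lip_norm \<rho> \<theta> \<beta> f)"
    using fin by (cases "Lip_norm \<rho> \<theta> \<beta> f") (auto simp: ennreal_le_iff)
  moreover have "m powr (1 + \<beta> / real CARD('n)) = m powr (\<beta> / real CARD('n)) * m"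
    using m by (simp add: powr_add)
  ultimately show ?thesis
    unfolding I_def[symmetric] m_def[symmetric] w_def[symmetric]
    using m w by (simp add: powr_minus field_simps)
qed

text \<open>If \<open>\<omega>\<^sup>q(B)\<close> is \<open>0\<close> or \<open>\<infinity>\<close>, the quotient in the weighted oscillation is \<open>0\<close>: the numerator
  vanishes as well in the first case, and division by \<open>\<infinity>\<close> gives \<open>0\<close> in the second.  Otherwise
  integrate \<open>\<bar>f - c\<bar>\<^sup>q \<omega>\<^sup>q \<le> M\<^sup>q \<omega>\<^sup>q\<close>, where \<open>c\<close> is the average of \<open>f\<close> over \<open>B\<close>.\<close>

lemma weighted_osc_le_if_AE_le:
  fixes f :: "real ^ 'n \<Rightarrow> real"
  assumes \<omega>: "\<omega> \<in> borel_measurable lebesgue" and B: "B \<in> sets lebesgue" and q: "0 < q" and M: "0 \<le> M"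
    and le: "AE x in lebesgue. x \<in> B \<longrightarrow> \<bar>f x - avg B f\<bar> \<le> M"
  shows "weighted_osc q \<beta> \<omega> f B \<le> ennreal (1 / measure lebesgue B powr (\<beta> / real CARD('n)) * M)"
proof -
  note [measurable] = \<omega> B
  let ?N = "\<integral>\<^sup>+x\<in>B. ennreal (\<bar>f x - avg B f\<bar> powr q * \<omega> x powr q) \<partial>lebesgue"
  have "?N \<le> (\<integral>\<^sup>+x. ennreal (M powr q) * (ennreal (\<omega> x powr q) * indicator B x) \<partial>lebesgue)"
  proof (intro nn_integral_mono_AE)
    show "AE x in lebesgue. ennreal (\<bar>f x - avg B f\<bar> powr q * \<omega> x powr q) * indicator B x
        \<le> ennreal (M powr q) * (ennreal (\<omega> x powr q) * indicator B x)"
      using le by eventually_elim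
        (use q in \<open>auto split: split_indicator intro!: ennreal_leI mult_right_mono powr_mono2
          simp flip: ennreal_mult\<close>)
  qed
  also have "\<dots> = ennreal (M powr q) * weight_measure \<omega> q B"
    unfolding weight_measure_def by (intro nn_integral_cmult) measurable
  finally have "?N / weight_measure \<omega> q B
      \<le> ennreal (M powr q) * (weight_measure \<omega> q B / weight_measure \<omega> q B)"
    by (simp add: ennreal_times_divide divide_right_mono_ennreal)
  also have "\<dots> \<le> ennreal (M powr q) * 1"
    by (intro mult_left_mono zero_le)
      (cases "weight_measure \<omega> q B = 0 \<or> weight_measure \<omega> q B = \<infinity>"; auto simp: less_top)
  finally have "ennreal_rpow (?N / weight_measure \<omega> q B) (1 / q) \<le> ennreal_rpow (ennreal (M powr q)) (1 / q)"
    using q by (intro ennreal_rpow_mono) auto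
  also have "\<dots> = ennreal M" using q M by (simp add: ennreal_rpow_ennreal powr_powr)
  finally have root: "ennreal_rpow (?N / weight_measure \<omega> q B) (1 / q) \<le> ennreal M" .
  have eq: "ennreal (1 / measure lebesgue B powr (\<beta> / real CARD('n)) * M)
      = ennreal (1 / measure lebesgue B powr (\<beta> / real CARD('n))) * ennreal M"
    using M by (intro ennreal_mult) auto
  from root show ?thesis
    unfolding weighted_osc_def eq by (intro mult_left_mono zero_le)
qed

text \<open>The factors of the constant are the one from telescoping, \<open>2\<^sup>\<beta>\<close> from starting at the radius \<open>2r\<close>, and
  \<open>(2C\<^sub>0 + 1)\<^sup>\<theta>\<close> from moving the centre.  The volume of the unit ball cancels against the
  normalisation by \<open>\<bar>B\<bar>\<^bsup>\<beta>/d\<^esup>\<close>.\<close>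

proposition Lip_imp_weighted_osc_bound:
  fixes V \<omega> f :: "real ^ 'n \<Rightarrow> real"
  assumes shen: "shen_constants (critical_radius V) C\<^sub>0 N\<^sub>0"
    and \<omega>: "\<omega> \<in> borel_measurable lebesgue"
    and q: "0 < q" and \<beta>: "0 < \<beta>" and \<theta>: "0 \<le> \<theta>" and r: "0 < r"
    and f: "f \<in> Lip_space (critical_radius V) \<theta> \<beta>"
  shows "weighted_osc q \<beta> \<omega> f (ball x\<^sub>0 r)
    \<le> ennreal ((2 ^ CARD('n) * (2 + 1 / (1 - 2 powr (- \<beta>))) * 2 powr \<beta> * (2 * C\<^sub>0 + 1) powr \<theta>)
        * (1 + r / critical_radius V x\<^sub>0) powr ((N\<^sub>0 + 1) * \<theta>))
      * Lip_norm (critical_radius V) \<theta> \<beta> f"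
proof -
  let ?\<rho> = "critical_radius V"
  define L where "L = enn2real (Lip_norm ?\<rho> \<theta> \<beta> f)"
  have floc: "locally_integrable f" and fin: "Lip_norm ?\<rho> \<theta> \<beta> f < \<infinity>"
    using f by (auto simp: Lip_space_def)
  have L: "0 \<le> L" "Lip_norm ?\<rho> \<theta> \<beta> f = ennreal L" using fin by (auto simp: L_def)
  have \<rho>: "0 < ?\<rho> x" for x by (rule shen_constants_imp_pos[OF shen])
  have C0: "1 \<le> C\<^sub>0" "0 < N\<^sub>0" using shen by (auto simp: shen_constants_def)
  define b where "b = 1 + r / ?\<rho> x\<^sub>0"
  have b: "1 \<le> b" using r \<rho>[of x\<^sub>0] by (simp add: b_def)
  define Q where "Q = (2 * C\<^sub>0 + 1) powr \<theta> * b powr ((N\<^sub>0 + 1) * \<theta>)"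
  define v where "v = measure lebesgue (ball (0 :: real ^ 'n) 1) powr (\<beta> / real CARD('n))"
  define \<Lambda> where "\<Lambda> = L * Q * v"
  define K where "K = 2 ^ CARD('n) * (2 + 1 / (1 - 2 powr (- \<beta>)))"
  have "2 powr (- \<beta>) < 1" using \<beta> by (simp add: powr_less_one)
  then have K: "0 \<le> K" by (simp add: K_def)
  have \<Lambda>: "0 \<le> \<Lambda>" using L by (simp add: \<Lambda>_def Q_def v_def)
  define M where "M = K * \<Lambda> * (2 * r) powr \<beta>"
  have M: "0 \<le> M" using K \<Lambda> by (simp add: M_def)
  have osc: "(LINT y:ball x s|lebesgue. \<bar>f y - avg (ball x s) f\<bar>)
      \<le> \<Lambda> * s powr \<beta> * measure lebesgue (ball x s)"
    if x: "x \<in> ball x\<^sub>0 r" and s: "0 < s" "s \<le> 2 * r" for x s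
  proof -
    have "(1 + s / ?\<rho> x) powr \<theta> \<le> ((2 * C\<^sub>0 + 1) * b powr (N\<^sub>0 + 1)) powr \<theta>"
    proof (rule powr_mono2)
      have "1 + s / ?\<rho> x \<le> 1 + 2 * r / ?\<rho> x" using s \<rho>[of x] by (simp add: divide_right_mono)
      also have "\<dots> \<le> (2 * C\<^sub>0 + 1) * b powr (N\<^sub>0 + 1)"
        unfolding b_def using x by (intro shen_constants_growth[OF shen \<rho> \<rho>]) simp
      finally show "1 + s / ?\<rho> x \<le> (2 * C\<^sub>0 + 1) * b powr (N\<^sub>0 + 1)" .
    qed (use \<theta> s \<rho>[of x] in auto)
    also have "\<dots> = Q" using C0 b by (simp add: Q_def powr_mult powr_powr)
    finally have "L * (1 + s / ?\<rho> x) powr \<theta> * (v * s powr \<beta>) * measure lebesgue (ball x s)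
        \<le> L * Q * (v * s powr \<beta>) * measure lebesgue (ball x s)"
      using L by (intro mult_left_mono mult_right_mono) (auto simp: v_def)
    moreover have "measure lebesgue (ball x s) powr (\<beta> / real CARD('n)) = v * s powr \<beta>"
      using s measure_ball_powr[of s x \<beta>] by (simp add: v_def)
    then have "(LINT y:ball x s|lebesgue. \<bar>f y - avg (ball x s) f\<bar>)
        \<le> L * (1 + s / ?\<rho> x) powr \<theta> * (v * s powr \<beta>) * measure lebesgue (ball x s)"
      using Lip_norm_osc_le[OF fin s(1), of x] \<rho>[of x] by (simp add: L_def)
    ultimately show ?thesis
      by (simp add: \<Lambda>_def mult.assoc)
  qed
  have fm: "f \<in> borel_measurable lebesgue" by (rule locally_integrable_measurable[OF floc])
  have "AE x in lebesgue. x \<in> ball x\<^sub>0 r \<longrightarrow> ennreal \<bar>f x - avg (ball x\<^sub>0 r) f\<bar> \<le> ennreal M"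
  proof (rule AE_le_if_small_ball_integrals_le)
    show "(\<lambda>x. ennreal \<bar>f x - avg (ball x\<^sub>0 r) f\<bar>) \<in> borel_measurable lebesgue"
      using fm by measurable
    fix x :: "real ^ 'n" and d :: real assume x: "x \<in> ball x\<^sub>0 r" and d: "0 < d"
    obtain k :: nat where "2 * r / d < 2 ^ k" using real_arch_pow[of 2 "2 * r / d"] by auto
    then have k: "2 * r / 2 ^ k < d" using d by (simp add: field_simps)
    have "(LINT y:ball x (2 * r / 2 ^ k)|lebesgue. \<bar>f y - avg (ball x\<^sub>0 r) f\<bar>)
        \<le> M * measure lebesgue (ball x (2 * r / 2 ^ k))"
      using small_ball_deviation_le[OF floc \<beta> r \<Lambda> x osc[OF x]] by (simp add: M_def K_def)
    then have "(\<integral>\<^sup>+y\<in>ball x (2 * r / 2 ^ k). ennreal \<bar>f y - avg (ball x\<^sub>0 r) f\<bar> \<partial>lebesgue)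
        \<le> ennreal M * emeasure lebesgue (ball x (2 * r / 2 ^ k))"
      using M by (simp add: nn_integral_abs_diff_const_ball[OF floc] emeasure_ball_lebesgue
          ennreal_leI flip: ennreal_mult)
    then show "\<exists>s. 0 < s \<and> s < d \<and> (\<integral>\<^sup>+y\<in>ball x s. ennreal \<bar>f y - avg (ball x\<^sub>0 r) f\<bar> \<partial>lebesgue)
        \<le> ennreal M * emeasure lebesgue (ball x s)"
      using k r by (intro exI[of _ "2 * r / 2 ^ k"]) auto
  qed (use M in auto)
  then have "AE x in lebesgue. x \<in> ball x\<^sub>0 r \<longrightarrow> \<bar>f x - avg (ball x\<^sub>0 r) f\<bar> \<le> M"
    by eventually_elim (use M in \<open>auto simp: ennreal_le_iff\<close>)
  then have "weighted_osc q \<beta> \<omega> f (ball x\<^sub>0 r)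
      \<le> ennreal (1 / measure lebesgue (ball x\<^sub>0 r) powr (\<beta> / real CARD('n)) * M)"
    using \<omega> q M by (intro weighted_osc_le_if_AE_le) auto
  also have "1 / measure lebesgue (ball x\<^sub>0 r) powr (\<beta> / real CARD('n)) * M = K * 2 powr \<beta> * Q * L"
  proof -
    have "0 < v" using measure_ball_lebesgue_pos[of 1 "0 :: real ^ 'n"] by (simp add: v_def)
    moreover have "measure lebesgue (ball x\<^sub>0 r) powr (\<beta> / real CARD('n)) = v * r powr \<beta>"
      using r measure_ball_powr[of r x\<^sub>0 \<beta>] by (simp add: v_def)
    ultimately show ?thesis
      using r unfolding M_def \<Lambda>_def by (simp add: powr_mult)
  qed
  also have "ennreal (K * 2 powr \<beta> * Q * L) = ennreal (K * 2 powr \<beta> * Q) * Lip_norm ?\<rho> \<theta> \<beta> f"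
    using L K by (simp add: ennreal_mult Q_def)
  finally show ?thesis by (simp add: K_def Q_def b_def algebra_simps)
qed

section \<open>Consequences of a finite weight constant\<close>

text \<open>The factor of the weight constant that measures \<open>\<omega>\<^sup>-\<^sup>1\<close>: its \<open>L\<^bsup>p'\<^esup>\<close> mean over \<open>B\<close>, which for \<open>p = 1\<close>
  is the essential supremum of \<open>\<omega>\<^sup>-\<^sup>1\<close>.\<close>

definition dual_factor :: "real \<Rightarrow> (real ^ 'n \<Rightarrow> real) \<Rightarrow> (real ^ 'n) set \<Rightarrow> ennreal" where
  "dual_factor p \<omega> B = (if p = 1 then inverse (ess_inf_on B \<omega>)
     else ennreal_rpow (nn_avg B (\<lambda>y. inverse (ennreal (\<omega> y powr (p / (p - 1)))))) ((p - 1) / p))"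

lemma Apq_const_upper:
  assumes "0 < r"
  shows "ennreal ((1 + r / \<rho> x) powr (- \<theta>)) *
      ennreal_rpow (nn_avg (ball x r) (\<lambda>y. ennreal (\<omega> y powr q))) (1 / q) *
      dual_factor p \<omega> (ball x r) \<le> Apq_const \<rho> \<theta> p q \<omega>"
  unfolding Apq_const_def dual_factor_def using assms
  by (intro SUP_upper2[of "(x, r)"]) auto

text \<open>The supremum that defines the essential infimum is attained, because it is the supremum of a
  sequence of lower bounds and a countable union of null sets is null.\<close>

lemma AE_ess_inf_on_le: "AE x in lebesgue. x \<in> B \<longrightarrow> ess_inf_on B \<omega> \<le> ennreal (\<omega> x)"
proof -
  define A where "A = {c. AE x in lebesgue. x \<in> B \<longrightarrow> c \<le> ennreal (\<omega> x)}"
  have "A \<noteq> {}" by (auto simp: A_def intro!: exI[of _ 0])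
  then obtain u :: "nat \<Rightarrow> ennreal" where u: "range u \<subseteq> A" "Sup A = (SUP n. u n)"
    by (metis ennreal_Sup_countable_SUP)
  then have "AE x in lebesgue. \<forall>n. x \<in> B \<longrightarrow> u n \<le> ennreal (\<omega> x)"
    by (subst AE_all_countable) (auto simp: A_def)
  then show ?thesis
    unfolding ess_inf_on_def A_def[symmetric] u(2)
    by eventually_elim (auto intro: SUP_least)
qed

lemma AE_pos_if_dual_factor_finite:
  fixes \<omega> :: "real ^ 'n \<Rightarrow> real"
  assumes \<omega>: "\<omega> \<in> borel_measurable lebesgue" "\<And>x. 0 \<le> \<omega> x"
    and B: "B \<in> sets lebesgue" "emeasure lebesgue B < \<infinity>"
    and fin: "dual_factor p \<omega> B < \<infinity>"
  shows "AE x in lebesgue. x \<in> B \<longrightarrow> 0 < \<omega> x"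
proof (cases "p = 1")
  case True
  then have "0 < ess_inf_on B \<omega>"
    using fin by (auto simp: dual_factor_def intro!: gr_zeroI)
  then show ?thesis
    using AE_ess_inf_on_le[of B \<omega>] by (auto elim!: eventually_mono dest: order_less_le_trans)
next
  case False
  let ?h = "\<lambda>y. inverse (ennreal (\<omega> y powr (p / (p - 1))))"
  note [measurable] = \<omega>(1) B(1)
  have "nn_avg B ?h \<noteq> \<infinity>"
    using fin False by (auto simp: dual_factor_def ennreal_rpow_def)
  moreover have "nn_avg B ?h = \<infinity>" if "(\<integral>\<^sup>+x\<in>B. ?h x \<partial>lebesgue) = \<infinity>"
    using B(2) unfolding nn_avg_def that by (simp add: ennreal_top_divide less_top[symmetric])
  ultimately have "(\<integral>\<^sup>+x\<in>B. ?h x \<partial>lebesgue) \<noteq> \<infinity>" by blast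
  then have "AE x in lebesgue. ?h x * indicator B x \<noteq> \<infinity>"
    by (intro nn_integral_PInf_AE) measurable
  then show ?thesis
  proof eventually_elim
    case (elim x)
    show ?case
    proof
      assume "x \<in> B"
      with elim have "\<omega> x \<noteq> 0" by auto
      then show "0 < \<omega> x" using \<omega>(2)[of x] by simp
    qed
  qed
qed

lemma dual_factor_pos:
  fixes \<omega> :: "real ^ 'n \<Rightarrow> real"
  assumes \<omega>: "\<omega> \<in> borel_measurable lebesgue"
    and B: "B \<in> sets lebesgue" "0 < emeasure lebesgue B" "emeasure lebesgue B < \<infinity>"
  shows "0 < dual_factor p \<omega> B"
proof -
  have ex: "\<exists>x. P x" if "AE x in lebesgue. x \<in> B \<longrightarrow> P x" for P
  proof (rule ccontr)
    assume "\<nexists>x. P x"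
    then have "AE x in lebesgue. x \<notin> B" using that by simp
    then have "emeasure lebesgue B = 0"
      using B(1) by (subst (asm) AE_iff_measurable[OF B(1)]) auto
    then show False using B(2) by simp
  qed
  show ?thesis
  proof (cases "p = 1")
    case True
    obtain x where "ess_inf_on B \<omega> \<le> ennreal (\<omega> x)" using ex[OF AE_ess_inf_on_le] by blast
    then have "ess_inf_on B \<omega> < \<infinity>" by (rule order_le_less_trans) simp
    then show ?thesis using True by (auto simp: dual_factor_def zero_less_iff_neq_zero)
  next
    case False
    have "nn_avg B (\<lambda>y. inverse (ennreal (\<omega> y powr (p / (p - 1))))) \<noteq> 0"
    proof
      assume "nn_avg B (\<lambda>y. inverse (ennreal (\<omega> y powr (p / (p - 1))))) = 0"
      then have "AE x in lebesgue. x \<in> B \<longrightarrow> inverse (ennreal (\<omega> x powr (p / (p - 1)))) = 0"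
        using \<omega> B by (subst (asm) nn_avg_eq_0_iff) auto
      from ex[OF this] show False by auto
    qed
    then show ?thesis using False by (simp add: dual_factor_def zero_less_iff_neq_zero)
  qed
qed

text \<open>The product \<open>0 * \<infinity>\<close> is \<open>0\<close>, so on a single ball a finite constant does not exclude that \<open>\<omega>\<close>
  vanishes.  But \<open>\<omega>\<close> is not almost everywhere \<open>0\<close>, hence the mean of \<open>\<omega>\<^sup>q\<close> is positive on all
  large balls about the origin; there the dual factor must be finite, which means \<open>\<omega> > 0\<close> almost
  everywhere on the ball.\<close>

lemma AE_pos_if_Apq_class:
  fixes \<omega> :: "real ^ 'n \<Rightarrow> real"
  assumes \<omega>: "\<omega> \<in> Apq_class \<rho> \<theta> p q" and \<rho>: "\<And>x. 0 \<le> \<rho> x"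
  shows "AE x in lebesgue. 0 < \<omega> x"
proof -
  have nonneg: "\<And>x. 0 \<le> \<omega> x" and loc: "locally_integrable \<omega>" and nz: "\<not> (AE x in lebesgue. \<omega> x = 0)"
    and fin: "Apq_const \<rho> \<theta> p q \<omega> < \<infinity>"
    using \<omega> by (auto simp: Apq_class_def weight_def)
  have meas[measurable]: "\<omega> \<in> borel_measurable lebesgue" by (rule locally_integrable_measurable[OF loc])
  have "\<exists>m. \<not> (AE x in lebesgue. x \<in> ball 0 (real m) \<longrightarrow> \<omega> x = 0)"
  proof (rule ccontr)
    assume "\<not> ?thesis"
    then have "AE x in lebesgue. \<forall>m. x \<in> ball 0 (real m) \<longrightarrow> \<omega> x = 0"
      by (subst AE_all_countable) blast
    then have "AE x in lebesgue. \<omega> x = 0"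
    proof eventually_elim
      case (elim x)
      obtain m where "norm x < real m" using reals_Archimedean2 by blast
      with elim show ?case by auto
    qed
    with nz show False by simp
  qed
  then obtain m where m: "\<not> (AE x in lebesgue. x \<in> ball 0 (real m) \<longrightarrow> \<omega> x = 0)" by blast
  \<comment> \<open>\<open>Suc k\<close> keeps the radius positive even when \<open>m = 0\<close>.\<close>
  have "AE x in lebesgue. x \<in> ball 0 (real (m + Suc k)) \<longrightarrow> 0 < \<omega> x" for k
  proof (rule AE_pos_if_dual_factor_finite[OF meas nonneg])
    define R where "R = real (m + Suc k)"
    have R: "0 < R" by (simp add: R_def)
    have "nn_avg (ball 0 R) (\<lambda>y. ennreal (\<omega> y powr q)) \<noteq> 0"
    proof
      assume "nn_avg (ball 0 R) (\<lambda>y. ennreal (\<omega> y powr q)) = 0"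
      then have "AE x in lebesgue. x \<in> ball 0 R \<longrightarrow> ennreal (\<omega> x powr q) = 0"
        by (subst (asm) nn_avg_eq_0_iff) (auto simp: emeasure_ball_lebesgue)
      then have "AE x in lebesgue. x \<in> ball 0 (real m) \<longrightarrow> \<omega> x = 0"
        by eventually_elim (auto simp: R_def ennreal_eq_0_iff)
      with m show False by simp
    qed
    moreover have "ennreal ((1 + R / \<rho> 0) powr (- \<theta>)) \<noteq> 0"
      using \<rho>[of 0] R by (simp add: add_nonneg_eq_0_iff)
    moreover have "ennreal ((1 + R / \<rho> 0) powr (- \<theta>)) *
        ennreal_rpow (nn_avg (ball 0 R) (\<lambda>y. ennreal (\<omega> y powr q))) (1 / q) *
        dual_factor p \<omega> (ball 0 R) < \<infinity>"
      using Apq_const_upper[OF R] fin by (rule order_le_less_trans)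
    ultimately show "dual_factor p \<omega> (ball 0 (real (m + Suc k))) < \<infinity>"
      unfolding R_def[symmetric]
      by (auto simp: less_top[symmetric] ennreal_mult_eq_top_iff)
  qed (auto simp: emeasure_ball_lebesgue)
  then have "AE x in lebesgue. \<forall>k. x \<in> ball 0 (real (m + Suc k)) \<longrightarrow> 0 < \<omega> x"
    by (subst AE_all_countable) blast
  then show ?thesis
  proof eventually_elim
    case (elim x)
    obtain k where "norm x < real k" using reals_Archimedean2 by blast
    with elim[rule_format, of k] show ?case by simp
  qed
qed

text \<open>The finite constant bounds the product of two factors, neither of which is \<open>0\<close> as \<open>\<omega>\<close> is
  positive and finite almost everywhere.  So neither can be \<open>\<infinity>\<close>.\<close>

lemma Apq_class_factors_finite:
  fixes \<omega> :: "real ^ 'n \<Rightarrow> real" and x :: "real ^ 'n"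
  assumes \<omega>: "\<omega> \<in> Apq_class \<rho> \<theta> p q" and \<rho>: "\<And>x. 0 \<le> \<rho> x" and r: "0 < r"
  defines "F \<equiv> nn_avg (ball x r) (\<lambda>y. ennreal (\<omega> y powr q))"
  shows "F \<noteq> 0" "F \<noteq> \<infinity>" "dual_factor p \<omega> (ball x r) < \<infinity>"
proof -
  have loc: "locally_integrable \<omega>" and fin: "Apq_const \<rho> \<theta> p q \<omega> < \<infinity>"
    using \<omega> by (auto simp: Apq_class_def weight_def)
  have meas[measurable]: "\<omega> \<in> borel_measurable lebesgue" by (rule locally_integrable_measurable[OF loc])
  have B: "ball x r \<in> sets lebesgue" "0 < emeasure lebesgue (ball x r)" "emeasure lebesgue (ball x r) < \<infinity>"
    using measure_ball_lebesgue_pos[OF r, of x] by (auto simp: emeasure_ball_lebesgue)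
  show F: "F \<noteq> 0"
  proof
    assume "F = 0"
    then have "AE y in lebesgue. y \<in> ball x r \<longrightarrow> ennreal (\<omega> y powr q) = 0"
      unfolding F_def using B by (subst (asm) nn_avg_eq_0_iff) auto
    with AE_pos_if_Apq_class[OF \<omega> \<rho>] have "AE y in lebesgue. y \<notin> ball x r"
      by eventually_elim (auto simp: ennreal_eq_0_iff)
    then have "emeasure lebesgue (ball x r) = 0"
      by (subst (asm) AE_iff_measurable[OF B(1)]) auto
    with B(2) show False by simp
  qed
  have D: "0 < dual_factor p \<omega> (ball x r)" by (rule dual_factor_pos[OF meas B])
  have c: "ennreal ((1 + r / \<rho> x) powr (- \<theta>)) \<noteq> 0"
    using \<rho>[of x] r by (simp add: add_nonneg_eq_0_iff)
  have "ennreal ((1 + r / \<rho> x) powr (- \<theta>)) * ennreal_rpow F (1 / q) * dual_factor p \<omega> (ball x r) < \<infinity>"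
    unfolding F_def using Apq_const_upper[OF r] fin by (rule order_le_less_trans)
  with c F D show "F \<noteq> \<infinity>" "dual_factor p \<omega> (ball x r) < \<infinity>"
    by (auto simp: less_top[symmetric] ennreal_mult_eq_top_iff)
qed

section \<open>From the weighted oscillation to the Lipschitz condition\<close>

text \<open>Hoelder's inequality for \<open>a = (a \<omega>) \<omega>\<^sup>-\<^sup>1\<close> with the exponents \<open>q\<close> and \<open>p'\<close>.  For \<open>p = 1\<close>
  the bound on \<open>\<omega>\<^sup>-\<^sup>1\<close> by its essential supremum is taken out first, and Hoelder's
  inequality with the constant function \<open>1\<close> and the exponent \<open>q' = q/(q - 1)\<close> compares the mean of
  \<open>a \<omega>\<close> with its \<open>L\<^sup>q\<close> mean.\<close>

lemma nn_avg_le_weighted_power_mean: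
  fixes a \<omega> :: "real ^ 'n \<Rightarrow> real"
  assumes a: "a \<in> borel_measurable lebesgue" "\<And>x. 0 \<le> a x"
    and \<omega>: "\<omega> \<in> borel_measurable lebesgue" "\<And>x. 0 \<le> \<omega> x" "AE x in lebesgue. 0 < \<omega> x"
    and B: "B \<in> sets lebesgue" "0 < emeasure lebesgue B" "emeasure lebesgue B < \<infinity>"
    and pq: "1 \<le> p" "p < q" and fin: "dual_factor p \<omega> B < \<infinity>"
  shows "nn_avg B (\<lambda>x. ennreal (a x))
    \<le> ennreal_rpow (nn_avg B (\<lambda>x. ennreal (a x powr q * \<omega> x powr q))) (1 / q) * dual_factor p \<omega> B"
proof (cases "p = 1")
  case True
  note [measurable] = a(1) \<omega>(1)
  let ?m = "ess_inf_on B \<omega>"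
  have m0: "0 < ?m" using fin True by (auto simp: dual_factor_def intro!: gr_zeroI)
  have "nn_avg B (\<lambda>x. ennreal (a x)) \<le> nn_avg B (\<lambda>x. inverse ?m * ennreal (a x * \<omega> x * 1))"
  proof (rule nn_avg_mono_AE)
    show "AE x in lebesgue. x \<in> B \<longrightarrow> ennreal (a x) \<le> inverse ?m * ennreal (a x * \<omega> x * 1)"
      using AE_ess_inf_on_le[of B \<omega>]
    proof eventually_elim
      case (elim x)
      show ?case
      proof
        assume "x \<in> B"
        with elim have le: "?m \<le> ennreal (\<omega> x)" by simp
        then have mtop: "?m \<noteq> \<infinity>" by (auto simp: top_unique)
        have "1 = inverse ?m * ?m"
          using m0 mtop ennreal_divide_self[of ?m]
          by (simp add: divide_ennreal_def mult.commute less_top)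
        also have "\<dots> \<le> inverse ?m * ennreal (\<omega> x)" by (rule mult_left_mono[OF le]) simp
        finally have "ennreal (a x) * 1 \<le> ennreal (a x) * (inverse ?m * ennreal (\<omega> x))"
          by (rule mult_left_mono) simp
        then show "ennreal (a x) \<le> inverse ?m * ennreal (a x * \<omega> x * 1)"
          using a(2) \<omega>(2) by (simp add: ennreal_mult ac_simps)
      qed
    qed
  qed
  also have "\<dots> = inverse ?m * nn_avg B (\<lambda>x. ennreal (a x * \<omega> x * 1))"
    using B by (intro nn_avg_cmult) measurable
  also have "\<dots> \<le> inverse ?m * (ennreal_rpow (nn_avg B (\<lambda>x. ennreal ((a x * \<omega> x) powr q))) (1 / q)
      * ennreal_rpow (nn_avg B (\<lambda>x. ennreal (1 powr (q / (q - 1))))) (1 / (q / (q - 1))))"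
    using a(2) \<omega>(2) B pq True
    by (intro mult_left_mono nn_avg_hoelder) (auto simp: field_simps)
  also have "ennreal_rpow (nn_avg B (\<lambda>x. ennreal (1 powr (q / (q - 1))))) (1 / (q / (q - 1))) = 1"
    using B by (simp add: nn_avg_const ennreal_rpow_def)
  finally show ?thesis
    using True a(2) \<omega>(2) by (simp add: dual_factor_def powr_mult mult.commute)
next
  case False
  note [measurable] = a(1) \<omega>(1)
  define s where "s = p / (p - 1)"
  have s: "0 < s" "1 / s = (p - 1) / p" using False pq by (auto simp: s_def)
  have "1 / q \<le> 1 / p" using pq by (simp add: frac_le)
  moreover have "(p - 1) / p = 1 - 1 / p" using pq by (simp add: field_simps)
  ultimately have qs: "1 / q + 1 / s \<le> 1" using s by simp
  have "nn_avg B (\<lambda>x. ennreal (a x)) \<le> nn_avg B (\<lambda>x. ennreal ((a x * \<omega> x) * inverse (\<omega> x)))"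
    by (rule nn_avg_mono_AE) (use \<omega>(3) in eventually_elim, auto simp: mult.assoc)
  also have "\<dots> \<le> ennreal_rpow (nn_avg B (\<lambda>x. ennreal ((a x * \<omega> x) powr q))) (1 / q)
      * ennreal_rpow (nn_avg B (\<lambda>x. ennreal (inverse (\<omega> x) powr s))) (1 / s)"
    using a(2) \<omega>(2) B pq qs s by (intro nn_avg_hoelder) auto
  also have "\<dots> \<le> ennreal_rpow (nn_avg B (\<lambda>x. ennreal ((a x * \<omega> x) powr q))) (1 / q)
      * ennreal_rpow (nn_avg B (\<lambda>x. inverse (ennreal (\<omega> x powr s)))) (1 / s)"
  proof (intro mult_left_mono ennreal_rpow_mono nn_avg_mono_AE)
    show "AE x in lebesgue. x \<in> B \<longrightarrow> ennreal (inverse (\<omega> x) powr s) \<le> inverse (ennreal (\<omega> x powr s))"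
      using \<omega>(3) by eventually_elim (simp add: inverse_ennreal inverse_powr)
  qed (use s(1) in auto)
  also have "ennreal_rpow (nn_avg B (\<lambda>x. inverse (ennreal (\<omega> x powr s)))) (1 / s) = dual_factor p \<omega> B"
    unfolding s(2) using False by (simp add: dual_factor_def s_def)
  finally show ?thesis
    using a(2) \<omega>(2) by (simp add: powr_mult)
qed

text \<open>One ball of the supremum that defines the norm.  With \<open>w = 1 + r/\<rho>(x)\<close> the powers combine as
  \<open>w\<^bsup>-\<theta>\<^sub>1\<^esup> w\<^bsup>\<theta>\<^sub>1 - \<theta>\<^sub>2\<^esup> = w\<^bsup>-\<theta>\<^sub>2\<^esup>\<close>, exactly the power in the weight constant.\<close>

proposition weighted_osc_bound_imp_Lip_term_le:
  fixes \<omega> f :: "real ^ 'n \<Rightarrow> real"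
  assumes \<omega>: "\<omega> \<in> Apq_class \<rho> \<theta>\<^sub>2 p q" and \<rho>: "\<And>x. 0 \<le> \<rho> x" and r: "0 < r"
    and pq: "1 \<le> p" "p < q" and f: "locally_integrable f" and C: "0 \<le> C"
    and osc: "weighted_osc q \<beta> \<omega> f (ball x r) \<le> ennreal (C * (1 + r / \<rho> x) powr (\<theta>\<^sub>1 - \<theta>\<^sub>2))"
  shows "ennreal ((1 + r / \<rho> x) powr (- \<theta>\<^sub>1) *
      (1 / measure lebesgue (ball x r) powr (1 + \<beta> / real CARD('n))) *
      (LINT y:ball x r|lebesgue. \<bar>f y - avg (ball x r) f\<bar>))
    \<le> ennreal C * Apq_const \<rho> \<theta>\<^sub>2 p q \<omega>"
proof -
  define B where "B = ball x r"
  define m where "m = measure lebesgue B"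
  define w where "w = 1 + r / \<rho> x"
  define I where "I = (LINT y:B|lebesgue. \<bar>f y - avg B f\<bar>)"
  define D where "D = dual_factor p \<omega> B"
  define F where "F = nn_avg B (\<lambda>y. ennreal (\<omega> y powr q))"
  define N where "N = (\<integral>\<^sup>+x\<in>B. ennreal (\<bar>f x - avg B f\<bar> powr q * \<omega> x powr q) \<partial>lebesgue)"
  define W where "W = weight_measure \<omega> q B"
  have m: "0 < m" "emeasure lebesgue B = ennreal m"
    using measure_ball_lebesgue_pos[OF r, of x] by (auto simp: emeasure_ball_lebesgue m_def B_def)
  have w: "1 \<le> w" using \<rho>[of x] r by (simp add: w_def)
  have nonneg: "\<And>x. 0 \<le> \<omega> x" and loc: "locally_integrable \<omega>"
    using \<omega> by (auto simp: Apq_class_def weight_def)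
  note [measurable] = locally_integrable_measurable[OF loc] locally_integrable_measurable[OF f]
  have Bset: "B \<in> sets lebesgue" by (simp add: B_def)
  have I0: "0 \<le> I" unfolding I_def set_lebesgue_integral_def by (intro integral_nonneg_AE) auto
  have F: "F \<noteq> 0" "F \<noteq> \<infinity>" "D < \<infinity>"
    using Apq_class_factors_finite[OF \<omega> \<rho> r, of x] by (auto simp: F_def D_def B_def)
  have FW: "F = W / ennreal m" by (simp add: F_def nn_avg_def W_def weight_measure_def m)
  have W: "W \<noteq> 0" "W \<noteq> \<infinity>" using F m by (auto simp: FW ennreal_top_divide)
  have "ennreal (w powr (- \<theta>\<^sub>1) * (1 / m powr (1 + \<beta> / real CARD('n))) * I)
      = ennreal (w powr (- \<theta>\<^sub>1)) * ennreal (1 / m powr (\<beta> / real CARD('n))) * ennreal (I / m)"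
    using m I0 by (simp add: powr_add flip: ennreal_mult)
  also have "ennreal (I / m) = nn_avg B (\<lambda>y. ennreal \<bar>f y - avg B f\<bar>)"
    using m I0 nn_integral_abs_diff_const_ball[OF f, where x = x and r = r and c = "avg B f"]
    by (simp add: nn_avg_def B_def[symmetric] I_def[symmetric] divide_ennreal)
  also have "\<dots> \<le> ennreal_rpow (nn_avg B (\<lambda>x. ennreal (\<bar>f x - avg B f\<bar> powr q * \<omega> x powr q))) (1 / q) * D"
    unfolding D_def
  proof (rule nn_avg_le_weighted_power_mean)
    show "AE x in lebesgue. 0 < \<omega> x" by (rule AE_pos_if_Apq_class[OF \<omega> \<rho>])
  qed (use nonneg Bset m pq F in \<open>auto simp: D_def\<close>)
  also have "nn_avg B (\<lambda>x. ennreal (\<bar>f x - avg B f\<bar> powr q * \<omega> x powr q)) = (N / W) * F"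
  proof -
    have "(N / W) * F = (N / W * W) / ennreal m" by (simp add: FW ennreal_times_divide)
    also have "N / W * W = N"
      using W by (simp add: ennreal_divide_times less_top ennreal_divide_self flip: ennreal_times_divide)
    finally show ?thesis by (simp add: nn_avg_def N_def m)
  qed
  also have "ennreal_rpow (N / W * F) (1 / q) = ennreal_rpow (N / W) (1 / q) * ennreal_rpow F (1 / q)"
    by (rule ennreal_rpow_mult)
  also have "ennreal (w powr (- \<theta>\<^sub>1)) * ennreal (1 / m powr (\<beta> / real CARD('n)))
        * (ennreal_rpow (N / W) (1 / q) * ennreal_rpow F (1 / q) * D)
      = ennreal (w powr (- \<theta>\<^sub>1)) * weighted_osc q \<beta> \<omega> f B * (ennreal_rpow F (1 / q) * D)"
    by (simp add: weighted_osc_def N_def W_def m_def ac_simps)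
  also have "\<dots> \<le> ennreal (w powr (- \<theta>\<^sub>1)) * ennreal (C * w powr (\<theta>\<^sub>1 - \<theta>\<^sub>2)) * (ennreal_rpow F (1 / q) * D)"
    using osc by (intro mult_left_mono mult_right_mono) (auto simp: w_def B_def)
  also have "ennreal (w powr (- \<theta>\<^sub>1)) * ennreal (C * w powr (\<theta>\<^sub>1 - \<theta>\<^sub>2)) = ennreal C * ennreal (w powr (- \<theta>\<^sub>2))"
    using C w by (simp add: powr_diff powr_minus field_simps flip: ennreal_mult)
  also have "ennreal C * ennreal (w powr (- \<theta>\<^sub>2)) * (ennreal_rpow F (1 / q) * D)
      = ennreal C * (ennreal (w powr (- \<theta>\<^sub>2)) * ennreal_rpow F (1 / q) * D)"
    by (simp add: ac_simps)
  also have "\<dots> \<le> ennreal C * Apq_const \<rho> \<theta>\<^sub>2 p q \<omega>"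
    unfolding w_def F_def D_def B_def using Apq_const_upper[OF r] by (intro mult_left_mono) auto
  finally show ?thesis
    by (simp add: w_def m_def I_def B_def mult_left_mono)
qed

theorem theorem3p5:
  fixes p q \<theta>\<^sub>2 \<beta> :: real
  assumes "3 \<le> CARD('n::finite)"
    and "1 \<le> p" and "p < q" and "0 < \<theta>\<^sub>2" and "0 < \<beta>" and "\<beta> < 1"
  shows
    "(\<forall>(V :: real ^ 'n \<Rightarrow> real) C\<^sub>0 N\<^sub>0 \<omega> \<theta>\<^sub>1.
        schrodinger_potential V \<longrightarrow>
        shen_constants (critical_radius V) C\<^sub>0 N\<^sub>0 \<longrightarrow>
        \<omega> \<in> Apq_class (critical_radius V) \<theta>\<^sub>2 p q \<longrightarrow>
        0 < \<theta>\<^sub>1 \<longrightarrow>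
        (\<exists>C>0. \<forall>f \<in> Lip_space (critical_radius V) \<theta>\<^sub>1 \<beta>. \<forall>x\<^sub>0 r. 0 < r \<longrightarrow>
           weighted_osc q \<beta> \<omega> f (ball x\<^sub>0 r)
           \<le> ennreal (C * (1 + r / critical_radius V x\<^sub>0) powr ((N\<^sub>0 + 1) * \<theta>\<^sub>1))
             * Lip_norm (critical_radius V) \<theta>\<^sub>1 \<beta> f))
     \<and>
     (\<forall>C>0. \<forall>\<theta>\<^sub>1>0. \<exists>C'>0. \<forall>(V :: real ^ 'n \<Rightarrow> real) \<omega> f.
        schrodinger_potential V \<longrightarrow>
        \<omega> \<in> Apq_class (critical_radius V) \<theta>\<^sub>2 p q \<longrightarrow>
        locally_integrable f \<longrightarrow>
        (\<forall>x\<^sub>0 r. 0 < r \<longrightarrow>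
           weighted_osc q \<beta> \<omega> f (ball x\<^sub>0 r)
           \<le> ennreal (C * (1 + r / critical_radius V x\<^sub>0) powr (\<theta>\<^sub>1 - \<theta>\<^sub>2))) \<longrightarrow>
        f \<in> Lip_space (critical_radius V) \<theta>\<^sub>1 \<beta> \<and>
        Lip_norm (critical_radius V) \<theta>\<^sub>1 \<beta> f
          \<le> ennreal C' * Apq_const (critical_radius V) \<theta>\<^sub>2 p q \<omega>)"
proof (intro conjI allI impI)
  fix V :: "real ^ 'n \<Rightarrow> real" and C\<^sub>0 N\<^sub>0 \<omega> and \<theta>\<^sub>1 :: real
  assume shen: "shen_constants (critical_radius V) C\<^sub>0 N\<^sub>0"
    and \<omega>: "\<omega> \<in> Apq_class (critical_radius V) \<theta>\<^sub>2 p q" and \<theta>\<^sub>1: "0 < \<theta>\<^sub>1"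
  let ?C = "2 ^ CARD('n) * (2 + 1 / (1 - 2 powr (- \<beta>))) * 2 powr \<beta> * (2 * C\<^sub>0 + 1) powr \<theta>\<^sub>1"
  have "2 powr (- \<beta>) < 1" "1 \<le> C\<^sub>0"
    using \<open>0 < \<beta>\<close> shen by (auto simp: powr_less_one shen_constants_def)
  then have "0 < ?C" by (auto intro!: mult_pos_pos add_pos_pos)
  moreover have "\<omega> \<in> borel_measurable lebesgue"
    using \<omega> by (auto simp: Apq_class_def weight_def intro: locally_integrable_measurable)
  ultimately show "\<exists>C>0. \<forall>f \<in> Lip_space (critical_radius V) \<theta>\<^sub>1 \<beta>. \<forall>x\<^sub>0 r. 0 < r \<longrightarrow>
      weighted_osc q \<beta> \<omega> f (ball x\<^sub>0 r)
      \<le> ennreal (C * (1 + r / critical_radius V x\<^sub>0) powr ((N\<^sub>0 + 1) * \<theta>\<^sub>1))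
        * Lip_norm (critical_radius V) \<theta>\<^sub>1 \<beta> f"
    using Lip_imp_weighted_osc_bound[OF shen, of \<omega> q \<beta> \<theta>\<^sub>1] assms \<theta>\<^sub>1
    by (intro exI[of _ ?C]) auto
next
  fix C \<theta>\<^sub>1 :: real
  assume C: "0 < C"
  show "\<exists>C'>0. \<forall>(V :: real ^ 'n \<Rightarrow> real) \<omega> f.
        schrodinger_potential V \<longrightarrow>
        \<omega> \<in> Apq_class (critical_radius V) \<theta>\<^sub>2 p q \<longrightarrow>
        locally_integrable f \<longrightarrow>
        (\<forall>x\<^sub>0 r. 0 < r \<longrightarrow>
           weighted_osc q \<beta> \<omega> f (ball x\<^sub>0 r)
           \<le> ennreal (C * (1 + r / critical_radius V x\<^sub>0) powr (\<theta>\<^sub>1 - \<theta>\<^sub>2))) \<longrightarrow>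
        f \<in> Lip_space (critical_radius V) \<theta>\<^sub>1 \<beta> \<and>
        Lip_norm (critical_radius V) \<theta>\<^sub>1 \<beta> f
          \<le> ennreal C' * Apq_const (critical_radius V) \<theta>\<^sub>2 p q \<omega>"
  proof (intro exI[of _ C] conjI[OF C] allI impI)
    fix V \<omega> f :: "real ^ 'n \<Rightarrow> real"
    let ?\<rho> = "critical_radius V"
    assume \<omega>: "\<omega> \<in> Apq_class ?\<rho> \<theta>\<^sub>2 p q" and f: "locally_integrable f"
      and osc: "\<forall>x\<^sub>0 r. 0 < r \<longrightarrow> weighted_osc q \<beta> \<omega> f (ball x\<^sub>0 r)
           \<le> ennreal (C * (1 + r / ?\<rho> x\<^sub>0) powr (\<theta>\<^sub>1 - \<theta>\<^sub>2))"
    have le: "Lip_norm ?\<rho> \<theta>\<^sub>1 \<beta> f \<le> ennreal C * Apq_const ?\<rho> \<theta>\<^sub>2 p q \<omega>"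
      unfolding Lip_norm_def
      using weighted_osc_bound_imp_Lip_term_le[OF \<omega> critical_radius_nonneg] assms f C osc
      by (auto intro!: SUP_least)
    also have "\<dots> < \<infinity>"
      using \<omega> by (auto simp: Apq_class_def ennreal_mult_less_top)
    finally show "f \<in> Lip_space ?\<rho> \<theta>\<^sub>1 \<beta> \<and>
        Lip_norm ?\<rho> \<theta>\<^sub>1 \<beta> f \<le> ennreal C * Apq_const ?\<rho> \<theta>\<^sub>2 p q \<omega>"
      using f le by (simp add: Lip_space_def)
  qed
qed

end
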